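(* Let $n_1,n_2\ge 1$ and masses $m_{i,j}>0$ ($i=1,2$, $1\le j\le n_i$) be fixed, and consider the one-dimensional hard core piston system described in the context. Let $\mathcal V\subset\mathbb R^{n_1+n_2+2}$ be a compact set for which there exist compact sets $A\subset(0,1)$, $B\subset\mathbb R$, $K\subset(0,\infty)$ such that every $h=(Q,W,s_{1,1},\dots,s_{1,n_1},s_{2,1},\dots,s_{2,n_2})\in\mathcal V$ satisfies $Q\in A$, $W\in B$, and $s_{i,j}\in K$ for all $i,j$. For an initial condition put $T_\varepsilon=\inf\{\tau\ge 0:\ \bar h(\tau)\notin\mathcal V\ \text{or}\ h_\varepsilon(\tau/\varepsilon)\notin\mathcal V\}$. Then for each $T>0$, $$\sup_{\substack{\text{initial conditions}\\ \text{s.t. }h_\varepsilon(0)\in\mathcal V}}\ \ \sup_{0\le\tau\le \min(T,T_\varepsilon)}\bigl|h_\varepsilon(\tau/\varepsilon)-\bar h(\tau)\bigr|=\mathcal O(\varepsilon)\qquad\text{as }\varepsilon=M^{-1/2}\to0,$$ i.e. there exist $C<\infty$ and $\varepsilon_1>0$ such that for all $0<\varepsilon\le\varepsilon_1$ the left-hand side is at most $C\varepsilon$.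
   Context: Hard core piston system. A piston (a point particle of mass $M$) at position $Q\in[0,1]$ with velocity $V=dQ/dt$ moves in the unit interval. To its left are $n_1$ point gas particles with positions $q_{1,j}\in[0,Q]$, velocities $v_{1,j}$, masses $m_{1,j}$; to its right are $n_2$ point gas particles with positions $q_{2,j}\in[Q,1]$, velocities $v_{2,j}$, masses $m_{2,j}$. Gas particles do not interact with each other; they move freely except for elastic collisions with the piston and with fixed walls at $0$ and $1$ (reflection at a wall reverses the velocity; a collision of a gas particle of mass $m$ with the piston conserves momentum and kinetic energy). If several gas particles hit the piston simultaneously (a measure zero event), the pairwise collisions are performed one after another in a fixed order, e.g. left particles before right particles. Time evolution is taken to be left continuous in $t$ at collisions. Notation: $\varepsilon=M^{-1/2}$, $W=V/\varepsilon$, $s_{i,j}=|v_{i,j}|$. The slow variables are $h=(Q,W,s_{1,1},\dots,s_{1,n_1},s_{2,1},\dots,s_{2,n_2})$, and $h_\varepsilon(t)$ denotes their actual evolution in time for the given $\varepsilon$, depending on the initial condition in the $2(n_1+n_2+1)$-dimensional phase space. Averaged equation: $\bar h(\tau)$ is the solution of $d\bar h/d\tau=\bar H(\bar h)$, $\bar h(0)=h_\varepsilon(0)$, where $\bar H(h)$ has the following components: $Q$-component $W$; $W$-component $\dfrac{\sum_{j=1}^{n_1}m_{1,j}s_{1,j}^2}{Q}-\dfrac{\sum_{j=1}^{n_2}m_{2,j}s_{2,j}^2}{1-Q}$; $s_{1,j}$-component $-\dfrac{s_{1,j}W}{Q}$; $s_{2,j}$-component $+\dfrac{s_{2,j}W}{1-Q}$.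 *)

theory Defs
  imports "HOL-Analysis.Analysis"
begin

text \<open>
  A state \<open>(Q, V, q\<^sub>1, v\<^sub>1, q\<^sub>2, v\<^sub>2)\<close> of the piston and the gas. The types \<open>'a\<close> and \<open>'b\<close> index
  the left and the right gas particles, so \<open>CARD('a)\<close> and \<open>CARD('b)\<close> are the (positive) numbers
  of particles; \<open>'a + 'b\<close> indexes all of them.
\<close>

type_synonym ('a, 'b) state =
  "real \<times> real \<times> (real ^ 'a) \<times> (real ^ 'a) \<times> (real ^ 'b) \<times> (real ^ 'b)"

text \<open>
  The slow variables \<open>(Q, W, s\<^sub>1, s\<^sub>2)\<close>; the norm of this product type is the Euclidean one.
\<close>

type_synonym ('a, 'b) slow = "real \<times> real \<times> (real ^ 'a) \<times> (real ^ 'b)"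

definition phase_space :: "('a::finite, 'b::finite) state set" where
  "phase_space = {(Q, V, q1, v1, q2, v2). 0 \<le> Q \<and> Q \<le> 1 \<and>
     (\<forall>j. 0 \<le> q1 $ j \<and> q1 $ j \<le> Q) \<and> (\<forall>j. Q \<le> q2 $ j \<and> q2 $ j \<le> 1)}"

fun free_flight :: "real \<Rightarrow> ('a::finite, 'b::finite) state \<Rightarrow> ('a, 'b) state" where
  "free_flight t (Q, V, q1, v1, q2, v2) =
     (Q + t * V, V, q1 + t *\<^sub>R v1, v1, q2 + t *\<^sub>R v2, v2)"

text \<open>
  Outgoing velocities of the piston (mass \<open>M\<close>, incoming velocity \<open>V\<close>) and of a gas particle
  (mass \<open>m\<close>, incoming velocity \<open>v\<close>) in an elastic collision.
\<close>

definition piston_out :: "real \<Rightarrow> real \<Rightarrow> real \<Rightarrow> real \<Rightarrow> real" where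
  "piston_out M m V v = ((M - m) * V + 2 * m * v) / (M + m)"

definition gas_out :: "real \<Rightarrow> real \<Rightarrow> real \<Rightarrow> real \<Rightarrow> real" where
  "gas_out M m V v = ((m - M) * v + 2 * M * V) / (M + m)"

lemma elastic_collision_iff:
  assumes "M > 0" "m > 0" "v \<noteq> V"
  shows "M * V' + m * v' = M * V + m * v \<and>
         M * V'\<^sup>2 / 2 + m * v'\<^sup>2 / 2 = M * V\<^sup>2 / 2 + m * v\<^sup>2 / 2 \<and> (V', v') \<noteq> (V, v)
         \<longleftrightarrow> V' = piston_out M m V v \<and> v' = gas_out M m V v"
proof -
  have M: "M + m > 0" using assms by simp
  have nz: "M + m \<noteq> 0" using M by simp
  show ?thesis
  proof
    assume L: "M * V' + m * v' = M * V + m * v \<and>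
      M * V'\<^sup>2 / 2 + m * v'\<^sup>2 / 2 = M * V\<^sup>2 / 2 + m * v\<^sup>2 / 2 \<and> (V', v') \<noteq> (V, v)"
    have mom: "M * (V' - V) = m * (v - v')" using L by (simp add: algebra_simps)
    have "M * V'\<^sup>2 + m * v'\<^sup>2 = M * V\<^sup>2 + m * v\<^sup>2" using L by simp
    then have en: "M * (V' - V) * (V' + V) = m * (v - v') * (v + v')"
      by (simp add: algebra_simps power2_eq_square)
    have "V' \<noteq> V"
    proof
      assume "V' = V"
      then have "v' = v" using mom assms by simp
      then show False using L \<open>V' = V\<close> by simp
    qed
    then have "M * (V' - V) \<noteq> 0" using assms by simp
    then have "V' + V = v + v'" using en mom by simp
    then have v': "v' = V' + V - v" by simp
    have "(M + m) * V' = (M - m) * V + 2 * m * v"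
      using mom unfolding v' by (simp add: algebra_simps)
    then have V': "V' = piston_out M m V v"
      unfolding piston_out_def using nz by (simp add: field_simps)
    have "(M + m) * v' = (M + m) * V' + (M + m) * (V - v)"
      unfolding v' by (simp add: algebra_simps)
    then have "(M + m) * v' = (m - M) * v + 2 * M * V"
      using \<open>(M + m) * V' = _\<close> by (simp add: algebra_simps)
    then have "v' = gas_out M m V v"
      unfolding gas_out_def using nz by (simp add: field_simps)
    with V' show "V' = piston_out M m V v \<and> v' = gas_out M m V v" by simp
  next
    assume R: "V' = piston_out M m V v \<and> v' = gas_out M m V v"
    have a: "V' = V + 2 * m * (v - V) / (M + m)"
      using R nz by (simp add: piston_out_def field_simps)
    have b: "v' = v - 2 * M * (v - V) / (M + m)"
      using R nz by (simp add: gas_out_def field_simps)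
    define d where "d = 2 * (v - V) / (M + m)"
    have a': "V' = V + m * d" and b': "v' = v - M * d"
      using a b by (simp_all add: d_def)
    have dd: "(M + m) * d = 2 * (v - V)" using nz by (simp add: d_def)
    have "M * V'\<^sup>2 + m * v'\<^sup>2 - (M * V\<^sup>2 + m * v\<^sup>2) = M * m * d * ((M + m) * d - 2 * (v - V))"
      unfolding a' b' by (simp add: algebra_simps power2_eq_square)
    then have "M * V'\<^sup>2 + m * v'\<^sup>2 = M * V\<^sup>2 + m * v\<^sup>2" using dd by simp
    moreover have "M * V' + m * v' = M * V + m * v"
      unfolding a' b' by (simp add: algebra_simps)
    moreover have "d \<noteq> 0" using assms nz by (simp add: d_def)
    then have "V' \<noteq> V" using assms by (simp add: a')
    ultimately show "M * V' + m * v' = M * V + m * v \<and>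
      M * V'\<^sup>2 / 2 + m * v'\<^sup>2 / 2 = M * V\<^sup>2 / 2 + m * v\<^sup>2 / 2 \<and> (V', v') \<noteq> (V, v)"
      by simp
  qed
qed

definition vec_upd :: "real ^ 'n \<Rightarrow> 'n::finite \<Rightarrow> real \<Rightarrow> real ^ 'n" where
  "vec_upd v j a = (\<chi> i. if i = j then a else v $ i)"

fun reflect_walls :: "('a::finite, 'b::finite) state \<Rightarrow> ('a, 'b) state" where
  "reflect_walls (Q, V, q1, v1, q2, v2) =
     (Q, V, q1, (\<chi> j. if q1 $ j = 0 \<and> v1 $ j < 0 then - (v1 $ j) else v1 $ j),
      q2, (\<chi> j. if q2 $ j = 1 \<and> v2 $ j > 0 then - (v2 $ j) else v2 $ j))"

fun hit_piston :: "real \<Rightarrow> real ^ 'a \<Rightarrow> real ^ 'b \<Rightarrow> 'a + 'b \<Rightarrow>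
    ('a::finite, 'b::finite) state \<Rightarrow> ('a, 'b) state" where
  "hit_piston M m1 m2 (Inl j) (Q, V, q1, v1, q2, v2) =
     (if q1 $ j = Q \<and> v1 $ j > V
      then (Q, piston_out M (m1 $ j) V (v1 $ j), q1,
            vec_upd v1 j (gas_out M (m1 $ j) V (v1 $ j)), q2, v2)
      else (Q, V, q1, v1, q2, v2))"
| "hit_piston M m1 m2 (Inr j) (Q, V, q1, v1, q2, v2) =
     (if q2 $ j = Q \<and> v2 $ j < V
      then (Q, piston_out M (m2 $ j) V (v2 $ j), q1, v1,
            q2, vec_upd v2 j (gas_out M (m2 $ j) V (v2 $ j)))
      else (Q, V, q1, v1, q2, v2))"

text \<open>
  Wall reflections, followed by the pairwise collisions with the piston in the fixed order given
  by the list \<open>ord\<close> of all gas particles.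
\<close>

definition collide :: "real \<Rightarrow> real ^ 'a \<Rightarrow> real ^ 'b \<Rightarrow> ('a + 'b) list \<Rightarrow>
    ('a::finite, 'b::finite) state \<Rightarrow> ('a, 'b) state" where
  "collide M m1 m2 ord z = fold (hit_piston M m1 m2) ord (reflect_walls z)"

definition separating :: "('a::finite, 'b::finite) state \<Rightarrow> bool" where
  "separating = (\<lambda>(Q, V, q1, v1, q2, v2).
     (\<forall>j. (q1 $ j = 0 \<longrightarrow> v1 $ j \<ge> 0) \<and> (q1 $ j = Q \<longrightarrow> v1 $ j \<le> V)) \<and>
     (\<forall>j. (q2 $ j = 1 \<longrightarrow> v2 $ j \<le> 0) \<and> (q2 $ j = Q \<longrightarrow> v2 $ j \<ge> V)))"

text \<open>
  \<open>post_collision M m1 m2 ord z z'\<close>: all collisions due in the state \<open>z\<close> lead to \<open>z'\<close>.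
  Iterating \<open>collide\<close> covers the event that particles hit the piston from both sides at once and
  that a later pairwise collision drives the piston back into a particle already treated (which
  does not happen for a heavy, slow piston). A separating state is a fixed point of \<open>collide\<close>,
  so there is at most one \<open>z'\<close>, and \<open>z' = z\<close> if no collision is due.
\<close>

definition post_collision :: "real \<Rightarrow> real ^ 'a \<Rightarrow> real ^ 'b \<Rightarrow> ('a + 'b) list \<Rightarrow>
    ('a::finite, 'b::finite) state \<Rightarrow> ('a, 'b) state \<Rightarrow> bool" where
  "post_collision M m1 m2 ord z z' \<longleftrightarrow>
     (\<exists>k. z' = (collide M m1 m2 ord ^^ k) z) \<and> separating z'"

lemma collide_separating: "separating z \<Longrightarrow> collide M m1 m2 ord z = z"
proof -
  assume s: "separating z"
  have 1: "reflect_walls z = z"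
  proof (cases z)
    case (fields Q V q1 v1 q2 v2)
    then show ?thesis using s
      by (force simp: separating_def vec_eq_iff)
  qed
  have 2: "hit_piston M m1 m2 i z = z" for i
  proof (cases z)
    case (fields Q V q1 v1 q2 v2)
    then show ?thesis using s
      by (cases i) (force simp: separating_def)+
  qed
  have "fold (hit_piston M m1 m2) l z = z" for l
    by (induction l) (simp_all add: 2)
  then show ?thesis by (simp add: collide_def 1)
qed

lemma post_collision_unique:
  assumes "post_collision M m1 m2 ord z z'" "post_collision M m1 m2 ord z z''"
  shows "z' = z''"
proof -
  define c where "c = collide M m1 m2 ord"
  obtain k l where k: "z' = (c ^^ k) z" and l: "z'' = (c ^^ l) z"
    and s: "separating z'" "separating z''"
    using assms by (auto simp: post_collision_def c_def)
  have fixed: "(c ^^ n) y = y" if "separating y" for n y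
    using that by (induction n) (simp_all add: c_def collide_separating)
  have "(c ^^ (k + l)) z = z''"
    using fixed [OF s(2)] l by (simp add: funpow_add)
  moreover have "(c ^^ (l + k)) z = z'"
    using fixed [OF s(1)] k by (simp add: funpow_add)
  ultimately show ?thesis by (simp add: add.commute)
qed

text \<open>
  \<open>x\<close> is the time evolution on \<open>[0, S]\<close>. By left continuity \<open>x t\<close> is the state just before the
  collisions at time \<open>t\<close>; immediately after \<open>t\<close> there is free flight from the post-collisional
  state. These conditions determine \<open>x\<close> on \<open>[0, S]\<close> by \<open>x 0\<close>.
\<close>

definition piston_trajectory :: "real \<Rightarrow> real ^ 'a \<Rightarrow> real ^ 'b \<Rightarrow> ('a + 'b) list \<Rightarrow> real \<Rightarrow>
    (real \<Rightarrow> ('a::finite, 'b::finite) state) \<Rightarrow> bool" where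
  "piston_trajectory M m1 m2 ord S x \<longleftrightarrow>
     (\<forall>t\<in>{0..S}. x t \<in> phase_space) \<and>
     (\<forall>t\<in>{0<..S}. (x \<longlongrightarrow> x t) (at_left t)) \<and>
     (\<forall>t\<in>{0..<S}. \<exists>z. post_collision M m1 m2 ord (x t) z \<and>
        (\<forall>\<^sub>F r in at_right 0. x (t + r) = free_flight r z))"

fun slow_vars :: "real \<Rightarrow> ('a::finite, 'b::finite) state \<Rightarrow> ('a, 'b) slow" where
  "slow_vars \<epsilon> (Q, V, q1, v1, q2, v2) = (Q, V / \<epsilon>, (\<chi> j. \<bar>v1 $ j\<bar>), (\<chi> j. \<bar>v2 $ j\<bar>))"

fun averaged_field :: "real ^ 'a \<Rightarrow> real ^ 'b \<Rightarrow> ('a::finite, 'b::finite) slow \<Rightarrow> ('a, 'b) slow" where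
  "averaged_field m1 m2 (Q, W, s1, s2) =
     (W,
      (\<Sum>j\<in>UNIV. m1 $ j * (s1 $ j)\<^sup>2) / Q - (\<Sum>j\<in>UNIV. m2 $ j * (s2 $ j)\<^sup>2) / (1 - Q),
      (\<chi> j. - (s1 $ j * W / Q)),
      (\<chi> j. s2 $ j * W / (1 - Q)))"

text \<open>
  The condition on \<open>Q = fst (h \<tau>)\<close> keeps the solution in the domain of the averaged field.
\<close>

definition averaged_solution :: "real ^ 'a \<Rightarrow> real ^ 'b \<Rightarrow> real \<Rightarrow>
    (real \<Rightarrow> ('a::finite, 'b::finite) slow) \<Rightarrow> bool" where
  "averaged_solution m1 m2 S h \<longleftrightarrow>
     (\<forall>\<tau>\<in>{0..S}. 0 < fst (h \<tau>) \<and> fst (h \<tau>) < 1 \<and>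
        (h has_vector_derivative averaged_field m1 m2 (h \<tau>)) (at \<tau> within {0..S}))"

text \<open>Extended real, so that the exit time is \<open>\<infinity>\<close> if \<open>\<V>\<close> is never left.\<close>

definition exit_time :: "('a::finite, 'b::finite) slow set \<Rightarrow> real \<Rightarrow>
    (real \<Rightarrow> ('a, 'b) state) \<Rightarrow> (real \<Rightarrow> ('a, 'b) slow) \<Rightarrow> ereal" where
  "exit_time \<V> \<epsilon> x h =
     Inf {ereal \<tau> | \<tau>. \<tau> \<ge> 0 \<and> (h \<tau> \<notin> \<V> \<or> slow_vars \<epsilon> (x (\<tau> / \<epsilon>)) \<notin> \<V>)}"

text \<open>
  The supremum over all initial conditions \<open>x 0\<close> and all times \<open>\<tau> \<le> min T T\<^sub>\<epsilon>\<close>, for the piston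
  mass \<open>M = 1 / \<epsilon>\<^sup>2\<close>. Both evolutions are only required up to an arbitrary horizon \<open>S \<ge> \<tau>\<close> (in
  slow time), so that no initial condition is excluded by what its evolution does after time
  \<open>T\<^sub>\<epsilon>\<close>. Values of \<open>x\<close> and \<open>h\<close> beyond the horizon have no influence on
  \<open>min S (exit_time \<V> \<epsilon> x h)\<close>.
\<close>

definition averaging_error :: "real ^ 'a \<Rightarrow> real ^ 'b \<Rightarrow> ('a + 'b) list \<Rightarrow>
    ('a::finite, 'b::finite) slow set \<Rightarrow> real \<Rightarrow> real \<Rightarrow> ereal" where
  "averaging_error m1 m2 ord \<V> T \<epsilon> =
     Sup {ereal (norm (slow_vars \<epsilon> (x (\<tau> / \<epsilon>)) - h \<tau>)) | x h S \<tau>.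
       piston_trajectory (1 / \<epsilon>\<^sup>2) m1 m2 ord (S / \<epsilon>) x \<and> slow_vars \<epsilon> (x 0) \<in> \<V> \<and>
       averaged_solution m1 m2 S h \<and> h 0 = slow_vars \<epsilon> (x 0) \<and>
       0 \<le> \<tau> \<and> \<tau> \<le> S \<and> ereal \<tau> \<le> min (ereal T) (exit_time \<V> \<epsilon> x h)}"

end

theory Submission
  imports Defs
begin

text \<open>
  The slow variables are corrected by terms of order \<open>\<epsilon>\<close> that depend on the phases of the gas
  particles. The corrected \<open>W\<close> does not jump because collisions conserve momentum, and the corrected
  speed of a particle, \<open>\<bar>Q v - V q\<bar> / Q\<close> on the left, does not change when that particle hits the wall or
  the piston, while a collision of another particle changes it only by the jump of \<open>V\<close>, which is
  \<open>O(\<epsilon>\<^sup>2)\<close>. In free flight the corrected variables move with the averaged field up to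
  \<open>O(\<epsilon>\<^sup>2)\<close>. The sum of the phases drops by a fixed amount at each collision and
  grows at a bounded rate in between. So the distance to the averaged solution plus a multiple of
  \<open>\<epsilon>\<^sup>2\<close> times this sum never jumps upwards, and a Gronwall argument over times of order
  \<open>1 / \<epsilon>\<close> gives an error \<open>O(\<epsilon>)\<close>.
\<close>

text \<open>One collision moves W and the speed of the particle that hits by O(\<epsilon>), and of
  order 1 / \<epsilon> collisions can occur up to time T / \<epsilon>, so adding up jumps only gives
  O(1). The weights q / Q and (1 - q) / (1 - Q), equal to 1 at the piston and 0 at the wall, spread
  each jump over the flight between collisions: up to sign, their derivative in free flight is the
  corrected speed divided by Q or 1 - Q. What remains of a jump is caused by the change of V alone.
  These remainders have to be summed without a count of collisions, since a trajectory is described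
  only locally and one collision event may take any number of rounds of \<open>collide\<close>; the
  phases act as a budget instead. A second obstacle is that the compact set controls only states
  just before collisions. Inside a collision event upper bounds on velocities come from energy
  conservation, and lower bounds on speeds from the piston being heavy and slow.\<close>

section \<open>Growth estimates\<close>

text \<open>The right-hand side solves U' = \<alpha> U + \<beta> with U(0) = g, and a first crossing
  of \<open>G\<close> above it is impossible. Left limits together with a one-sided bound to the
  right leave \<open>G\<close> free to jump down, as it may at collisions.\<close>

lemma exponential_growth_bound:
  fixes G :: "real \<Rightarrow> real"
  assumes \<alpha>: "\<alpha> > 0"
    and left: "\<And>t. 0 < t \<Longrightarrow> t \<le> S \<Longrightarrow> (G \<longlongrightarrow> G t) (at_left t)"
    and right: "\<And>t. 0 \<le> t \<Longrightarrow> t < S \<Longrightarrow>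
      \<forall>\<^sub>F r in at_right 0. G (t + r) \<le> G t + r * (\<alpha> * G t + \<beta>)"
    and G0: "G 0 \<le> g" and nonneg: "g \<ge> 0" "\<beta> \<ge> 0" and t: "0 \<le> t" "t \<le> S"
  shows "G t \<le> (g + \<beta> / \<alpha>) * exp (\<alpha> * t) - \<beta> / \<alpha>"
proof (rule ccontr)
  define \<gamma> where "\<gamma> = g + \<beta> / \<alpha>"
  define U where "U = (\<lambda>t. \<gamma> * exp (\<alpha> * t) - \<beta> / \<alpha>)"
  assume "\<not> ?thesis"
  then have tU: "U t < G t" by (simp add: U_def \<gamma>_def)
  have \<gamma>: "\<gamma> \<ge> 0" using \<alpha> nonneg by (simp add: \<gamma>_def)
    define X where "X = {s. 0 \<le> s \<and> s \<le> S \<and> U s < G s}"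
    have tX: "t \<in> X" using tU t by (simp add: X_def)
    have bX: "bdd_below X" by (rule bdd_belowI [of _ 0]) (simp add: X_def)
    define t0 where "t0 = Inf X"
    have t0: "0 \<le> t0" "t0 \<le> t"
      unfolding t0_def using tX bX by (auto intro: cInf_greatest cInf_lower simp: X_def)
    have below: "G s \<le> U s" if "0 \<le> s" "s < t0" for s
    proof (rule ccontr)
      assume "\<not> G s \<le> U s"
      then have "s \<in> X" using that t0 t by (simp add: X_def)
      then have "t0 \<le> s" unfolding t0_def by (rule cInf_lower [OF _ bX])
      then show False using that by simp
    qed
    have at_t0: "G t0 \<le> U t0"
    proof (cases "t0 = 0")
      case True
      then show ?thesis using G0 by (simp add: U_def \<gamma>_def)
    next
      case False
      then have pos: "0 < t0" using t0 by simp
      have "(U \<longlongrightarrow> U t0) (at_left t0)"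
        unfolding U_def by (intro tendsto_intros)
      moreover have "\<forall>\<^sub>F s in at_left t0. G s \<le> U s"
        using eventually_at_left_real [OF pos] by eventually_elim (auto intro: below)
      ultimately show ?thesis
        using left [OF pos] t0 t by (intro tendsto_le [of "at_left t0" U _ G]) auto
    qed
    have "t0 < S" using t0 t tU at_t0 by (cases "t0 = S") auto
    from right [OF t0(1) this] obtain d where d: "d > 0"
      "\<And>r. 0 < r \<Longrightarrow> r < d \<Longrightarrow> G (t0 + r) \<le> G t0 + r * (\<alpha> * G t0 + \<beta>)"
      by (auto simp: eventually_at_right_field)
    have above: "G (t0 + r) \<le> U (t0 + r)" if r: "0 \<le> r" "r < d" for r
    proof (cases "r = 0")
      case False
      then have "r > 0" using r by simp
      then have "G (t0 + r) \<le> G t0 + r * (\<alpha> * G t0 + \<beta>)" using d r by blast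
      also have "\<dots> \<le> U t0 + r * (\<alpha> * U t0 + \<beta>)"
        using at_t0 \<alpha> r by (intro add_mono mult_left_mono) auto
      also have "\<dots> = \<gamma> * exp (\<alpha> * t0) * (1 + \<alpha> * r) - \<beta> / \<alpha>"
        using \<alpha> by (simp add: U_def field_simps)
      \<comment> \<open>The step bound is the tangent line of \<open>U\<close> at \<open>t0\<close>,
        which lies below the convex function \<open>U\<close>.\<close>
      also have "\<dots> \<le> \<gamma> * exp (\<alpha> * t0) * exp (\<alpha> * r) - \<beta> / \<alpha>"
        using \<gamma> exp_ge_add_one_self [of "\<alpha> * r"] by (intro diff_right_mono mult_left_mono) auto
      also have "\<dots> = U (t0 + r)" by (simp add: U_def exp_add distrib_left)
      finally show ?thesis .
    qed (simp add: at_t0)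
    have "t0 + d \<le> Inf X"
    proof (rule cInf_greatest)
      show "X \<noteq> {}" using tX by blast
      fix s assume s: "s \<in> X"
      then have "t0 \<le> s" unfolding t0_def by (rule cInf_lower [OF _ bX])
      then show "t0 + d \<le> s"
        using above [of "s - t0"] s by (cases "s < t0 + d") (auto simp: X_def)
    qed
    then show False using d by (simp add: t0_def)
qed

section \<open>Componentwise bounds for the Euclidean norm of slow variables\<close>

lemma norm_slow_le:
  fixes u :: "real ^ 'a::finite" and w :: "real ^ 'b::finite"
  shows "norm (x :: real, y :: real, u, w) \<le> \<bar>x\<bar> + \<bar>y\<bar> + (\<Sum>j\<in>UNIV. \<bar>u $ j\<bar>) + (\<Sum>j\<in>UNIV. \<bar>w $ j\<bar>)"
proof -
  have "norm (x, y, u, w) \<le> norm x + (norm y + (norm u + norm w))"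
    by (meson add_left_mono norm_Pair_le order_trans)
  then show ?thesis using norm_le_l1_cart [of u] norm_le_l1_cart [of w] by simp
qed

lemma slow_component_le_norm:
  fixes u :: "real ^ 'a::finite" and w :: "real ^ 'b::finite"
  shows "\<bar>x\<bar> \<le> norm (x :: real, y :: real, u, w)" "\<bar>y\<bar> \<le> norm (x, y, u, w)"
    "\<bar>u $ i\<bar> \<le> norm (x, y, u, w)" "\<bar>w $ j\<bar> \<le> norm (x, y, u, w)"
proof -
  have 1: "norm (y, u, w) \<le> norm (x, y, u, w)" by (rule norm_snd_le)
  have 2: "norm (u, w) \<le> norm (y, u, w)" by (rule norm_snd_le)
  have 3: "norm u \<le> norm (u, w)" "norm w \<le> norm (u, w)"
    by (rule norm_fst_le, rule norm_snd_le)
  show "\<bar>x\<bar> \<le> norm (x, y, u, w)" using norm_fst_le [of x] by simp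
  show "\<bar>y\<bar> \<le> norm (x, y, u, w)" using norm_fst_le [of y "(u, w)"] 1 by simp
  show "\<bar>u $ i\<bar> \<le> norm (x, y, u, w)" using component_le_norm_cart [of u i] 1 2 3 by linarith
  show "\<bar>w $ j\<bar> \<le> norm (x, y, u, w)" using component_le_norm_cart [of w j] 1 2 3 by linarith
qed

section \<open>Lipschitz bound for the averaged field\<close>

text \<open>
  The averaged field with each quadratic factor \<open>s\<^sup>2\<close> split as \<open>s * p\<close>: with \<open>p\<close> the corrected speed
  this is the exact rate of change of the corrected slow variables.
\<close>

definition split_field :: "real ^ 'a \<Rightarrow> real ^ 'b \<Rightarrow> real \<Rightarrow> real \<Rightarrow> real ^ 'a \<Rightarrow> real ^ 'b \<Rightarrow>
    real ^ 'a \<Rightarrow> real ^ 'b \<Rightarrow> ('a::finite, 'b::finite) slow" where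
  "split_field m1 m2 Q W s1 s2 p1 p2 =
     (W,
      (\<Sum>j\<in>UNIV. m1 $ j * (s1 $ j * p1 $ j)) / Q - (\<Sum>j\<in>UNIV. m2 $ j * (s2 $ j * p2 $ j)) / (1 - Q),
      (\<chi> j. - (p1 $ j * W / Q)), (\<chi> j. p2 $ j * W / (1 - Q)))"

lemma averaged_field_eq_split:
  "averaged_field m1 m2 (Q, W, s1, s2) = split_field m1 m2 Q W s1 s2 s1 s2"
  by (simp add: split_field_def power2_eq_square)

text \<open>Telescoping through \<open>x' * y * z\<close> and \<open>x' * y' * z\<close> exchanges
  one factor at a time, so bounds on \<open>x'\<close>, \<open>y\<close>, \<open>y'\<close> and
  \<open>z\<close> suffice.\<close>

lemma triple_product_diff:
  fixes x y z x' y' z' :: real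
  assumes "\<bar>x - x'\<bar> \<le> \<delta>" "\<bar>y - y'\<bar> \<le> \<delta>" "\<bar>z - z'\<bar> \<le> \<delta>"
    and "\<bar>x'\<bar> \<le> R" "\<bar>y\<bar> \<le> R" "\<bar>y'\<bar> \<le> R" "\<bar>z\<bar> \<le> R"
  shows "\<bar>x * y * z - x' * y' * z'\<bar> \<le> 3 * R\<^sup>2 * \<delta>"
proof -
  have R: "R \<ge> 0" "\<delta> \<ge> 0" using assms by linarith+
  have "x * y * z - x' * y' * z' = (x - x') * (y * z) + x' * ((y - y') * z) + x' * (y' * (z - z'))"
    by (simp add: algebra_simps)
  also have "\<bar>\<dots>\<bar> \<le> \<bar>x - x'\<bar> * (\<bar>y\<bar> * \<bar>z\<bar>) + \<bar>x'\<bar> * (\<bar>y - y'\<bar> * \<bar>z\<bar>) + \<bar>x'\<bar> * (\<bar>y'\<bar> * \<bar>z - z'\<bar>)"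
    by (simp only: abs_mult [symmetric])
  also have "\<dots> \<le> \<delta> * (R * R) + R * (\<delta> * R) + R * (R * \<delta>)"
    using assms R by (intro add_mono mult_mono mult_nonneg_nonneg) auto
  finally show ?thesis by (simp add: power2_eq_square algebra_simps)
qed

lemma inverse_diff_le:
  fixes x y a :: real
  assumes "a > 0" "a \<le> x" "a \<le> y"
  shows "\<bar>1 / x - 1 / y\<bar> \<le> \<bar>x - y\<bar> / a\<^sup>2"
proof -
  have "\<bar>1 / x - 1 / y\<bar> = \<bar>x - y\<bar> / (x * y)"
    using assms by (simp add: divide_simps abs_mult)
  also have "\<dots> \<le> \<bar>x - y\<bar> / a\<^sup>2"
    using assms unfolding power2_eq_square by (intro divide_left_mono mult_mono mult_pos_pos) auto
  finally show ?thesis .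
qed

text \<open>The first factor enlarges a bound on differences of arguments so that it also covers
  differences of 1 / Q and 1 / (1 - Q). All factors of the products in the field are at most
  \<open>\<bar>R\<bar> + 1 / a\<close>, and 3 is the number of factors. In the last bracket the
  masses belong to the W-component and the cardinalities to the speeds; the summand 1 before it
  belongs to the Q-component.\<close>

definition field_lipschitz :: "real ^ 'a::finite \<Rightarrow> real ^ 'b::finite \<Rightarrow> real \<Rightarrow> real \<Rightarrow> real" where
  "field_lipschitz m1 m2 a R = (1 + 1 / a\<^sup>2) * (1 + 3 * (\<bar>R\<bar> + 1 / a)\<^sup>2 *
     ((\<Sum>j\<in>UNIV. \<bar>m1 $ j\<bar>) + (\<Sum>j\<in>UNIV. \<bar>m2 $ j\<bar>) + real CARD('a) + real CARD('b)))"

lemma field_lipschitz_pos: "field_lipschitz m1 m2 a R > 0"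
  unfolding field_lipschitz_def
  by (intro mult_pos_pos add_pos_nonneg mult_nonneg_nonneg add_nonneg_nonneg sum_nonneg) auto

text \<open>Apart from the first component, everything is built from products of three factors such
  as s * p * (1 / Q). Both \<open>s\<close> and \<open>p\<close> are compared with the same
  \<open>s'\<close>, so \<open>\<delta>\<close> has to bound the distance of the uncorrected and of
  the corrected speeds from the averaged ones.\<close>

lemma split_field_lipschitz:
  fixes m1 :: "real ^ 'a::finite" and m2 :: "real ^ 'b::finite"
  assumes a: "a > 0"
    and Q: "a \<le> Q" "Q \<le> 1 - a" "a \<le> Q'" "Q' \<le> 1 - a" and W: "\<bar>W\<bar> \<le> R" "\<bar>W'\<bar> \<le> R"
    and 1: "\<And>j. \<bar>s1 $ j\<bar> \<le> R \<and> \<bar>s1' $ j\<bar> \<le> R \<and> \<bar>p1 $ j\<bar> \<le> R"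
    and 2: "\<And>j. \<bar>s2 $ j\<bar> \<le> R \<and> \<bar>s2' $ j\<bar> \<le> R \<and> \<bar>p2 $ j\<bar> \<le> R"
    and dQ: "\<bar>Q - Q'\<bar> \<le> \<delta>" and dW: "\<bar>W - W'\<bar> \<le> \<delta>"
    and d1: "\<And>j. \<bar>s1 $ j - s1' $ j\<bar> \<le> \<delta> \<and> \<bar>p1 $ j - s1' $ j\<bar> \<le> \<delta>"
    and d2: "\<And>j. \<bar>s2 $ j - s2' $ j\<bar> \<le> \<delta> \<and> \<bar>p2 $ j - s2' $ j\<bar> \<le> \<delta>"
  shows "norm (split_field m1 m2 Q W s1 s2 p1 p2 - split_field m1 m2 Q' W' s1' s2' s1' s2')
    \<le> field_lipschitz m1 m2 a R * \<delta>"
proof -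
  define r where "r = \<bar>R\<bar> + 1 / a"
  define b where "b = 1 + 1 / a\<^sup>2"
  define \<mu> where "\<mu> = (\<Sum>j\<in>UNIV. \<bar>m1 $ j\<bar>) + (\<Sum>j\<in>UNIV. \<bar>m2 $ j\<bar>)"
  define c where "c = 3 * r\<^sup>2"
  have r: "\<bar>R\<bar> \<le> r" "1 / a \<le> r" using a by (auto simp: r_def)
  have b: "1 \<le> b" "1 / a\<^sup>2 \<le> b" using a by (auto simp: b_def)
  have \<mu>: "\<mu> \<ge> 0" by (simp add: \<mu>_def sum_nonneg)
  have c: "c \<ge> 0" by (simp add: c_def)
  define d where "d = b * \<delta>"
  have \<delta>: "\<delta> \<ge> 0" using dQ by simp
  have dd: "\<delta> \<le> d" unfolding d_def using b \<delta> mult_right_mono [of 1 b \<delta>] by simp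
  have inv: "\<bar>1 / x - 1 / y\<bar> \<le> d" "\<bar>1 / x\<bar> \<le> r" "\<bar>1 / y\<bar> \<le> r"
    if "a \<le> x" "a \<le> y" "\<bar>x - y\<bar> \<le> \<delta>" for x y :: real
  proof -
    have "\<bar>1 / x - 1 / y\<bar> \<le> \<bar>x - y\<bar> * (1 / a\<^sup>2)" using inverse_diff_le [of a x y] a that by simp
    also have "\<dots> \<le> \<delta> * b" using that b \<delta> by (intro mult_mono) auto
    finally show "\<bar>1 / x - 1 / y\<bar> \<le> d" by (simp add: d_def mult.commute)
    have "1 / x \<le> 1 / a" "1 / y \<le> 1 / a" using a that by (auto intro: divide_left_mono)
    then show "\<bar>1 / x\<bar> \<le> r" "\<bar>1 / y\<bar> \<le> r" using r a that by auto
  qed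
  have iQ: "\<bar>1 / Q - 1 / Q'\<bar> \<le> d" "\<bar>1 / Q\<bar> \<le> r" "\<bar>1 / Q'\<bar> \<le> r"
    using inv [of Q Q'] Q dQ by auto
  have iQ': "\<bar>1 / (1 - Q) - 1 / (1 - Q')\<bar> \<le> d" "\<bar>1 / (1 - Q)\<bar> \<le> r" "\<bar>1 / (1 - Q')\<bar> \<le> r"
    using inv [of "1 - Q" "1 - Q'"] Q dQ by auto
  have t: "\<bar>x * y * z - x' * y' * z'\<bar> \<le> c * d"
    if "\<bar>x - x'\<bar> \<le> \<delta>" "\<bar>y - y'\<bar> \<le> \<delta>" "\<bar>z - z'\<bar> \<le> d"
      "\<bar>x'\<bar> \<le> R" "\<bar>y\<bar> \<le> R" "\<bar>y'\<bar> \<le> R" "\<bar>z\<bar> \<le> r" for x y z x' y' z' :: real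
    unfolding c_def using that dd r by (intro triple_product_diff) auto
  have t1: "\<bar>s1 $ j * p1 $ j * (1 / Q) - s1' $ j * s1' $ j * (1 / Q')\<bar> \<le> c * d" for j
    using 1 d1 iQ by (intro t) auto
  have t2: "\<bar>s2 $ j * p2 $ j * (1 / (1 - Q)) - s2' $ j * s2' $ j * (1 / (1 - Q'))\<bar> \<le> c * d" for j
    using 2 d2 iQ' by (intro t) auto
  have t3: "\<bar>p1 $ j * W * (1 / Q) - s1' $ j * W' * (1 / Q')\<bar> \<le> c * d" for j
    using 1 d1 iQ W dW by (intro t) auto
  have t4: "\<bar>p2 $ j * W * (1 / (1 - Q)) - s2' $ j * W' * (1 / (1 - Q'))\<bar> \<le> c * d" for j
    using 2 d2 iQ' W dW by (intro t) auto
  have S1: "\<bar>(\<Sum>j\<in>UNIV. m1 $ j * (s1 $ j * p1 $ j)) / Q - (\<Sum>j\<in>UNIV. m1 $ j * (s1' $ j * s1' $ j)) / Q'\<bar>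
      \<le> (\<Sum>j\<in>UNIV. \<bar>m1 $ j\<bar>) * (c * d)"
  proof -
    have "(\<Sum>j\<in>UNIV. m1 $ j * (s1 $ j * p1 $ j)) / Q - (\<Sum>j\<in>UNIV. m1 $ j * (s1' $ j * s1' $ j)) / Q'
      = (\<Sum>j\<in>UNIV. m1 $ j * (s1 $ j * p1 $ j * (1 / Q) - s1' $ j * s1' $ j * (1 / Q')))"
      by (simp add: sum_divide_distrib sum_subtractf [symmetric] right_diff_distrib)
    also have "\<bar>\<dots>\<bar> \<le> (\<Sum>j\<in>UNIV. \<bar>m1 $ j\<bar> * (c * d))"
      by (rule order_trans [OF sum_abs])
         (intro sum_mono, simp only: abs_mult, intro mult_left_mono t1, auto)
    finally show ?thesis by (simp add: sum_distrib_right)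
  qed
  have S2: "\<bar>(\<Sum>j\<in>UNIV. m2 $ j * (s2 $ j * p2 $ j)) / (1 - Q) - (\<Sum>j\<in>UNIV. m2 $ j * (s2' $ j * s2' $ j)) / (1 - Q')\<bar>
      \<le> (\<Sum>j\<in>UNIV. \<bar>m2 $ j\<bar>) * (c * d)"
  proof -
    have "(\<Sum>j\<in>UNIV. m2 $ j * (s2 $ j * p2 $ j)) / (1 - Q) - (\<Sum>j\<in>UNIV. m2 $ j * (s2' $ j * s2' $ j)) / (1 - Q')
      = (\<Sum>j\<in>UNIV. m2 $ j * (s2 $ j * p2 $ j * (1 / (1 - Q)) - s2' $ j * s2' $ j * (1 / (1 - Q'))))"
      by (simp add: sum_divide_distrib sum_subtractf [symmetric] right_diff_distrib)
    also have "\<bar>\<dots>\<bar> \<le> (\<Sum>j\<in>UNIV. \<bar>m2 $ j\<bar> * (c * d))"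
      by (rule order_trans [OF sum_abs])
         (intro sum_mono, simp only: abs_mult, intro mult_left_mono t2, auto)
    finally show ?thesis by (simp add: sum_distrib_right)
  qed
  have S3: "(\<Sum>j\<in>UNIV. \<bar>- (p1 $ j * W / Q) - - (s1' $ j * W' / Q')\<bar>) \<le> real CARD('a) * (c * d)"
    using sum_bounded_above [of UNIV "\<lambda>j. \<bar>- (p1 $ j * W / Q) - - (s1' $ j * W' / Q')\<bar>" "c * d"] t3
    by (simp add: abs_minus_commute)
  have S4: "(\<Sum>j\<in>UNIV. \<bar>p2 $ j * W / (1 - Q) - s2' $ j * W' / (1 - Q')\<bar>) \<le> real CARD('b) * (c * d)"
    using sum_bounded_above [of UNIV "\<lambda>j. \<bar>p2 $ j * W / (1 - Q) - s2' $ j * W' / (1 - Q')\<bar>" "c * d"] t4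
    by simp
  have "norm (split_field m1 m2 Q W s1 s2 p1 p2 - split_field m1 m2 Q' W' s1' s2' s1' s2')
    \<le> d + (\<mu> * (c * d)) + real CARD('a) * (c * d) + real CARD('b) * (c * d)"
  proof -
    have "norm (split_field m1 m2 Q W s1 s2 p1 p2 - split_field m1 m2 Q' W' s1' s2' s1' s2')
      \<le> \<bar>W - W'\<bar> +
        \<bar>(\<Sum>j\<in>UNIV. m1 $ j * (s1 $ j * p1 $ j)) / Q - (\<Sum>j\<in>UNIV. m2 $ j * (s2 $ j * p2 $ j)) / (1 - Q) -
         ((\<Sum>j\<in>UNIV. m1 $ j * (s1' $ j * s1' $ j)) / Q' - (\<Sum>j\<in>UNIV. m2 $ j * (s2' $ j * s2' $ j)) / (1 - Q'))\<bar> +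
        (\<Sum>j\<in>UNIV. \<bar>- (p1 $ j * W / Q) - - (s1' $ j * W' / Q')\<bar>) +
        (\<Sum>j\<in>UNIV. \<bar>p2 $ j * W / (1 - Q) - s2' $ j * W' / (1 - Q')\<bar>)"
      unfolding split_field_def diff_Pair
      by (rule order_trans [OF norm_slow_le]) (simp only: vector_minus_component vec_lambda_beta order_refl)
    then show ?thesis using S1 S2 S3 S4 dW dd unfolding \<mu>_def distrib_right [of "sum _ _"] by linarith
  qed
  also have "\<dots> = b * (1 + c * (\<mu> + real CARD('a) + real CARD('b))) * \<delta>"
    by (simp add: d_def algebra_simps)
  also have "\<dots> = field_lipschitz m1 m2 a R * \<delta>"
    by (simp only: field_lipschitz_def b_def c_def r_def \<mu>_def)
  finally show ?thesis .
qed

section \<open>Corrected slow variables and collisions\<close>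

text \<open>As M = 1 / \<epsilon>^2, the quotient V / \<epsilon> is \<epsilon> times the momentum of
  the piston. The second component is thus \<epsilon> times a total momentum in which a gas particle
  counts fully at the piston and not at all at its wall. The corrected speeds interpolate in the
  same way between the speed, kept by a wall, and the speed relative to the piston, kept by an
  elastic collision.\<close>

fun corrected_slow :: "real \<Rightarrow> real ^ 'a \<Rightarrow> real ^ 'b \<Rightarrow> ('a::finite, 'b::finite) state \<Rightarrow> ('a, 'b) slow"
  where
  "corrected_slow \<epsilon> m1 m2 (Q, V, q1, v1, q2, v2) =
     (Q,
      V / \<epsilon> + \<epsilon> * ((\<Sum>j\<in>UNIV. m1 $ j * v1 $ j * q1 $ j) / Q +
        (\<Sum>j\<in>UNIV. m2 $ j * v2 $ j * (1 - q2 $ j)) / (1 - Q)),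
      (\<chi> j. \<bar>v1 $ j\<bar> - V * sgn (v1 $ j) * (q1 $ j / Q)),
      (\<chi> j. \<bar>v2 $ j\<bar> - V * sgn (v2 $ j) * ((1 - q2 $ j) / (1 - Q))))"

text \<open>For a heavy, slow piston each particle contributes a sawtooth: -1 just after it hits the
  piston, 0 at the wall, 1 just before the next hit. The second sum is subtracted because a right
  particle approaches the piston with negative velocity.\<close>

fun phase_sum :: "('a::finite, 'b::finite) state \<Rightarrow> real" where
  "phase_sum (Q, V, q1, v1, q2, v2) =
     (\<Sum>j\<in>UNIV. sgn (v1 $ j) * (q1 $ j / Q)) - (\<Sum>j\<in>UNIV. sgn (v2 $ j) * ((1 - q2 $ j) / (1 - Q)))"

text \<open>Twice the kinetic energy, for piston mass 1 / \<epsilon>^2.\<close>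

fun energy :: "real \<Rightarrow> real ^ 'a \<Rightarrow> real ^ 'b \<Rightarrow> ('a::finite, 'b::finite) state \<Rightarrow> real" where
  "energy \<epsilon> m1 m2 (Q, V, q1, v1, q2, v2) =
     V\<^sup>2 / \<epsilon>\<^sup>2 + (\<Sum>j\<in>UNIV. m1 $ j * (v1 $ j)\<^sup>2) + (\<Sum>j\<in>UNIV. m2 $ j * (v2 $ j)\<^sup>2)"

lemma sum_vec_upd:
  fixes v :: "real ^ 'n::finite" and f :: "'n \<Rightarrow> real \<Rightarrow> real"
  shows "(\<Sum>i\<in>UNIV. f i (vec_upd v j b $ i)) = (\<Sum>i\<in>UNIV. f i (v $ i)) + (f j b - f j (v $ j))"
proof -
  have "(\<Sum>i\<in>UNIV. f i (vec_upd v j b $ i)) = f j b + (\<Sum>i\<in>UNIV - {j}. f i (v $ i))"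
    by (subst sum.remove [of _ j]) (auto simp: vec_upd_def intro!: sum.cong)
  moreover have "(\<Sum>i\<in>UNIV. f i (v $ i)) = f j (v $ j) + (\<Sum>i\<in>UNIV - {j}. f i (v $ i))"
    by (rule sum.remove) auto
  ultimately show ?thesis by simp
qed

lemma vec_upd_nth: "vec_upd v j b $ i = (if i = j then b else v $ i)"
  by (simp add: vec_upd_def)

lemma abs_sgn_mult_le_one: "\<bar>x\<bar> \<le> 1 \<Longrightarrow> \<bar>sgn (v :: real) * x\<bar> \<le> 1"
  by (simp add: abs_mult sgn_if)

text \<open>Here \<open>a\<close> keeps the piston off the walls, \<open>k\<close> bounds
  pre-collisional speeds from below, \<open>E\<close> bounds \<open>energy\<close> and
  \<open>\<mu>\<close> the masses; all are chosen before \<epsilon>. The bound k / 16 makes the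
  piston slow compared with the gas, and 1 / 4 makes it heavy. The conditions on \<open>E\<close>
  turn an energy bound into the velocity bound \<open>R\<close>.\<close>

locale slow_piston =
  fixes m1 :: "real ^ 'a::finite" and m2 :: "real ^ 'b::finite" and \<epsilon> a k E R \<mu> n :: real
  assumes eps: "0 < \<epsilon>" "\<epsilon> \<le> 1" "\<epsilon> * R \<le> k / 16" "\<mu> * \<epsilon>\<^sup>2 \<le> 1 / 4"
    and pos: "0 < a" "0 < k" "1 \<le> R"
    and m1: "\<And>j. 0 < m1 $ j" "\<And>j. m1 $ j \<le> \<mu>" "\<And>j. E \<le> m1 $ j * R\<^sup>2"
    and m2: "\<And>j. 0 < m2 $ j" "\<And>j. m2 $ j \<le> \<mu>" "\<And>j. E \<le> m2 $ j * R\<^sup>2"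
    and E: "E \<le> R\<^sup>2"
    and n_def: "n = real CARD('a) + real CARD('b)"
begin

text \<open>
  The second disjuncts describe particles that have just left the piston: their speed is no longer
  known to be at least \<open>k\<close>, but they cannot hit the piston again before the next free flight.
\<close>

fun admissible :: "('a, 'b) state \<Rightarrow> bool" where
  "admissible (Q, V, q1, v1, q2, v2) \<longleftrightarrow>
     a \<le> Q \<and> Q \<le> 1 - a \<and>
     (\<forall>j. 0 \<le> q1 $ j \<and> q1 $ j \<le> Q \<and> (k \<le> \<bar>v1 $ j\<bar> \<or> q1 $ j = Q \<and> v1 $ j \<le> - k / 2)) \<and>
     (\<forall>j. Q \<le> q2 $ j \<and> q2 $ j \<le> 1 \<and> (k \<le> \<bar>v2 $ j\<bar> \<or> q2 $ j = Q \<and> k / 2 \<le> v2 $ j)) \<and>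
     energy \<epsilon> m1 m2 (Q, V, q1, v1, q2, v2) \<le> E"

lemma n_ge_1: "n \<ge> 1"
proof -
  have "1 \<le> real CARD('a)" by (simp add: Suc_leI)
  then show ?thesis unfolding n_def by linarith
qed

lemma mu_pos: "\<mu> > 0"
  using m1(1) [of undefined] m1(2) [of undefined] by linarith

text \<open>The terms of \<open>energy\<close> are nonnegative, so each is at most \<open>E\<close>.
  Since collisions conserve \<open>energy\<close>, these bounds also hold inside a collision
  event.\<close>

lemma energy_bounds:
  assumes "energy \<epsilon> m1 m2 (Q, V, q1, v1, q2, v2) \<le> E"
  shows "\<bar>V\<bar> \<le> \<epsilon> * R" "\<bar>v1 $ i\<bar> \<le> R" "\<bar>v2 $ j\<bar> \<le> R"
proof -
  have nn: "0 \<le> V\<^sup>2 / \<epsilon>\<^sup>2" "0 \<le> (\<Sum>j\<in>UNIV. m1 $ j * (v1 $ j)\<^sup>2)" "0 \<le> (\<Sum>j\<in>UNIV. m2 $ j * (v2 $ j)\<^sup>2)"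
    using m1(1) m2(1) by (auto intro!: sum_nonneg simp: less_imp_le)
  have "V\<^sup>2 / \<epsilon>\<^sup>2 \<le> R\<^sup>2" using nn assms E by simp
  then have "V\<^sup>2 \<le> (\<epsilon> * R)\<^sup>2" using eps by (simp add: power_mult_distrib divide_le_eq mult.commute)
  then show "\<bar>V\<bar> \<le> \<epsilon> * R" using eps pos by (intro power2_le_imp_le [of "\<bar>V\<bar>"]) auto
  have "m1 $ i * (v1 $ i)\<^sup>2 \<le> (\<Sum>j\<in>UNIV. m1 $ j * (v1 $ j)\<^sup>2)"
    using m1(1) by (intro member_le_sum) (auto simp: less_imp_le)
  then have "m1 $ i * (v1 $ i)\<^sup>2 \<le> m1 $ i * R\<^sup>2"
    using nn assms m1(3) [of i] unfolding energy.simps by linarith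
  then have "(v1 $ i)\<^sup>2 \<le> R\<^sup>2" using m1(1) by simp
  then show "\<bar>v1 $ i\<bar> \<le> R" using pos by (intro power2_le_imp_le [of "\<bar>v1 $ i\<bar>"]) auto
  have "m2 $ j * (v2 $ j)\<^sup>2 \<le> (\<Sum>j\<in>UNIV. m2 $ j * (v2 $ j)\<^sup>2)"
    using m2(1) by (intro member_le_sum) (auto simp: less_imp_le)
  then have "m2 $ j * (v2 $ j)\<^sup>2 \<le> m2 $ j * R\<^sup>2"
    using nn assms m2(3) [of j] unfolding energy.simps by linarith
  then have "(v2 $ j)\<^sup>2 \<le> R\<^sup>2" using m2(1) by simp
  then show "\<bar>v2 $ j\<bar> \<le> R" using pos by (intro power2_le_imp_le [of "\<bar>v2 $ j\<bar>"]) auto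
qed

lemma phase_bounds:
  assumes "admissible (Q, V, q1, v1, q2, v2)"
  shows "\<bar>q1 $ i / Q\<bar> \<le> 1" "\<bar>(1 - q2 $ j) / (1 - Q)\<bar> \<le> 1"
  using assms pos by auto

text \<open>The gas particle loses the velocity \<open>d\<close>, so the piston gains
  \<open>m * d\<close> divided by its mass. The third relation is the reversal of the relative
  velocity; energy conservation and the invariance of the corrected speed are read off from it. The
  loss from k to k / 2 leaves room for the recoil and the motion of the piston.\<close>

lemma collision_velocities:
  fixes V v m :: real
  assumes m: "0 < m" "m \<le> \<mu>" and V: "\<bar>V\<bar> \<le> \<epsilon> * R" and v: "\<bar>v\<bar> \<le> R"
  obtains d where "piston_out (1 / \<epsilon>\<^sup>2) m V v = V + m * \<epsilon>\<^sup>2 * d" "gas_out (1 / \<epsilon>\<^sup>2) m V v = v - d"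
    "d * (1 + m * \<epsilon>\<^sup>2) = 2 * (v - V)" "\<bar>d\<bar> \<le> 4 * R"
    "k \<le> v \<Longrightarrow> v - d \<le> - k / 2" "v \<le> - k \<Longrightarrow> k / 2 \<le> v - d"
proof -
  \<comment> \<open>The mass ratio m / M.\<close>
  define x where "x = m * \<epsilon>\<^sup>2"
  have e2: "\<epsilon>\<^sup>2 > 0" using eps by simp
  have x: "0 < x" "x \<le> 1 / 4"
    using m e2 order_trans [OF mult_right_mono [of m \<mu> "\<epsilon>\<^sup>2"] eps(4)] by (auto simp: x_def)
  define d where "d = 2 * (v - V) / (1 + x)"
  have d: "d * (1 + x) = 2 * (v - V)" using x by (simp add: d_def)
  have eV: "\<bar>V\<bar> \<le> k / 16" "\<bar>V\<bar> \<le> R"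
    using V eps pos mult_right_mono [of \<epsilon> 1 R] by linarith+
  show thesis
  proof (rule that [of d])
    have 1: "1 / \<epsilon>\<^sup>2 + m = (1 + x) / \<epsilon>\<^sup>2" "1 / \<epsilon>\<^sup>2 - m = (1 - x) / \<epsilon>\<^sup>2"
      using e2 by (auto simp: x_def field_simps)
    have mx: "2 * m * v = 2 * x * v / \<epsilon>\<^sup>2" and mx': "m - 1 / \<epsilon>\<^sup>2 = (x - 1) / \<epsilon>\<^sup>2"
      using e2 by (auto simp: x_def field_simps)
    have "piston_out (1 / \<epsilon>\<^sup>2) m V v = ((1 - x) * V + 2 * x * v) / (1 + x)"
      unfolding piston_out_def 1 mx using e2 x by (simp add: divide_simps)
    also have "\<dots> = V + x * d" using x by (simp add: d_def field_simps)
    finally show "piston_out (1 / \<epsilon>\<^sup>2) m V v = V + m * \<epsilon>\<^sup>2 * d" by (simp add: x_def)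
    have "gas_out (1 / \<epsilon>\<^sup>2) m V v = ((x - 1) * v + 2 * V) / (1 + x)"
      unfolding gas_out_def 1 mx' using e2 x by (simp add: divide_simps)
    also have "\<dots> = v - d" using x by (simp add: d_def field_simps)
    finally show "gas_out (1 / \<epsilon>\<^sup>2) m V v = v - d" .
    show "d * (1 + m * \<epsilon>\<^sup>2) = 2 * (v - V)" using d by (simp add: x_def)
    have "\<bar>d\<bar> * 1 \<le> \<bar>d\<bar> * (1 + x)" using x by (intro mult_left_mono) auto
    also have "\<dots> = \<bar>2 * (v - V)\<bar>" using x by (simp only: d [symmetric] abs_mult)
    finally show "\<bar>d\<bar> \<le> 4 * R" using v eV by simp
    have vd: "(v - d) * (1 + x) = - v * (1 - x) + 2 * V" using d by (simp add: algebra_simps)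
    show "v - d \<le> - k / 2" if kv: "k \<le> v"
    proof -
      \<comment> \<open>Origin of the constants 1 / 16 and 1 / 4 of the locale: - 3 k / 4 + 2 k / 16
        = - (k / 2) (5 / 4), and 1 + x is at most 5 / 4.\<close>
      have "k * (3 / 4) \<le> v * (1 - x)" using kv x pos by (intro mult_mono) auto
      then have "(v - d) * (1 + x) \<le> - (k / 2) * (5 / 4)" using vd eV by simp
      also have "\<dots> \<le> - (k / 2) * (1 + x)" using x pos by (intro mult_left_mono_neg) auto
      finally have "(v - d) * (1 + x) \<le> - (k / 2) * (1 + x)" .
      then show ?thesis using x mult_right_le_imp_le [of "v - d" "1 + x" "- (k / 2)"] by simp
    qed
    show "k / 2 \<le> v - d" if kv: "v \<le> - k"
    proof -
      have "k * (3 / 4) \<le> - v * (1 - x)" using kv x pos by (intro mult_mono) auto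
      then have "(k / 2) * (5 / 4) \<le> (v - d) * (1 + x)" using vd eV by simp
      moreover have "(k / 2) * (1 + x) \<le> (k / 2) * (5 / 4)" using x pos by (intro mult_left_mono) auto
      ultimately have "(k / 2) * (1 + x) \<le> (v - d) * (1 + x)" by linarith
      then show ?thesis using x by simp
    qed
  qed
qed

text \<open>
  Every collision lowers \<open>phase_sum\<close> by 2, so that this bound sums up the jumps of the corrected
  slow variables without counting collisions.
\<close>

definition resolves :: "('a, 'b) state \<Rightarrow> ('a, 'b) state \<Rightarrow> bool" where
  "resolves z z' \<longleftrightarrow> admissible z' \<and>
     norm (corrected_slow \<epsilon> m1 m2 z' - corrected_slow \<epsilon> m1 m2 z)
       \<le> 2 * n * \<mu> * R * \<epsilon>\<^sup>2 * (phase_sum z - phase_sum z')"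

lemma resolves_admissible: "resolves z z' \<Longrightarrow> admissible z'"
  by (simp add: resolves_def)

lemma resolves_refl: "admissible z \<Longrightarrow> resolves z z"
  by (simp add: resolves_def)

lemma resolves_trans:
  assumes "resolves x y" "resolves y z"
  shows "resolves x z"
proof -
  let ?h = "corrected_slow \<epsilon> m1 m2" and ?c = "2 * n * \<mu> * R * \<epsilon>\<^sup>2"
  have "norm (?h z - ?h x) \<le> norm (?h z - ?h y) + norm (?h y - ?h x)"
    using norm_triangle_ineq [of "?h z - ?h y" "?h y - ?h x"] by simp
  also have "\<dots> \<le> ?c * (phase_sum y - phase_sum z) + ?c * (phase_sum x - phase_sum y)"
    using assms by (auto simp: resolves_def intro: add_mono)
  also have "\<dots> = ?c * (phase_sum x - phase_sum z)" by (simp add: algebra_simps)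
  finally show ?thesis using assms by (simp add: resolves_def)
qed

section \<open>From single collisions and wall reflections to a whole collision event\<close>

lemma momentum_transfer_le:
  assumes "0 < m" "m \<le> \<mu>" "\<bar>d\<bar> \<le> 4 * R"
  shows "\<bar>m * \<epsilon>\<^sup>2 * d\<bar> \<le> \<mu> * \<epsilon>\<^sup>2 * (4 * R)"
  using assms eps mu_pos by (simp only: abs_mult) (intro mult_mono, auto)

lemma sum_components_le:
  fixes f :: "'a \<Rightarrow> real" and g :: "'b \<Rightarrow> real"
  assumes "\<And>j. f j \<le> c" "\<And>j. g j \<le> c"
  shows "sum f UNIV + sum g UNIV \<le> n * c"
  using sum_bounded_above [of UNIV f c] sum_bounded_above [of UNIV g c] assms
  by (simp add: n_def distrib_right)

text \<open>Momentum conservation fixes the second component and the reversed relative velocity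
  fixes the corrected speed of the particle itself. Only the other speeds jump, each by at most the
  change of V, which is at most 4 \<mu> R \<epsilon>^2. With at most \<open>n\<close> components and
  a drop of the phase sum by 2, this yields the factor
  \<open>2 * n * \<mu> * R * \<epsilon>\<^sup>2\<close> of \<open>resolves\<close>.\<close>

lemma hit_left_resolves:
  assumes z: "admissible (Q, V, q1, v1, q2, v2)" and hit: "q1 $ j = Q" "v1 $ j > V"
  shows "resolves (Q, V, q1, v1, q2, v2)
    (Q, piston_out (1 / \<epsilon>\<^sup>2) (m1 $ j) V (v1 $ j), q1,
     vec_upd v1 j (gas_out (1 / \<epsilon>\<^sup>2) (m1 $ j) V (v1 $ j)), q2, v2)"
proof -
  let ?m = "m1 $ j" and ?v = "v1 $ j"
  have en: "energy \<epsilon> m1 m2 (Q, V, q1, v1, q2, v2) \<le> E" using z by simp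
  note eb = energy_bounds [OF en]
  have Q: "0 < Q" "Q < 1" using z pos by auto
  have V: "\<bar>V\<bar> \<le> k / 16" using eb(1) eps by linarith
  \<comment> \<open>A particle that may be slower than \<open>k\<close> recedes with speed at least
    k / 2, while |V| is at most k / 16, so it cannot satisfy v > V.\<close>
  have kv: "k \<le> ?v"
  proof -
    have "k \<le> \<bar>?v\<bar> \<or> ?v \<le> - k / 2" using z by auto
    then show ?thesis using V hit pos by linarith
  qed
  obtain d where d: "piston_out (1 / \<epsilon>\<^sup>2) ?m V ?v = V + ?m * \<epsilon>\<^sup>2 * d" "gas_out (1 / \<epsilon>\<^sup>2) ?m V ?v = ?v - d"
    "d * (1 + ?m * \<epsilon>\<^sup>2) = 2 * (?v - V)" "\<bar>d\<bar> \<le> 4 * R" "?v - d \<le> - k / 2"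
    using collision_velocities [OF m1(1) m1(2) eb(1) eb(2), of j j] kv by metis
  let ?D = "?m * \<epsilon>\<^sup>2 * d"
  let ?u = "vec_upd v1 j (?v - d)"
  have e2: "\<epsilon>\<^sup>2 > 0" using eps by simp
  \<comment> \<open>The change of energy contains the factor
    \<open>d * (1 + ?m * \<epsilon>\<^sup>2) - 2 * (?v - V)\<close>, which vanishes.\<close>
  have "energy \<epsilon> m1 m2 (Q, V + ?D, q1, ?u, q2, v2) = energy \<epsilon> m1 m2 (Q, V, q1, v1, q2, v2)
    + (((V + ?D)\<^sup>2 - V\<^sup>2) / \<epsilon>\<^sup>2 + ?m * ((?v - d)\<^sup>2 - ?v\<^sup>2))"
    by (simp add: sum_vec_upd [where f="\<lambda>i x. m1 $ i * x\<^sup>2"] diff_divide_distrib right_diff_distrib)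
  moreover have "((V + ?D)\<^sup>2 - V\<^sup>2) / \<epsilon>\<^sup>2 = ?m * (2 * V * d + ?m * \<epsilon>\<^sup>2 * d\<^sup>2)"
    using eps by (simp add: power2_eq_square field_simps)
  moreover have "?m * (2 * V * d + ?m * \<epsilon>\<^sup>2 * d\<^sup>2) + ?m * ((?v - d)\<^sup>2 - ?v\<^sup>2)
    = ?m * d * (d * (1 + ?m * \<epsilon>\<^sup>2) - 2 * (?v - V))"
    by (simp add: power2_eq_square algebra_simps)
  ultimately have en': "energy \<epsilon> m1 m2 (Q, V + ?D, q1, ?u, q2, v2) \<le> E" using en d(3) by simp
  have adm: "admissible (Q, V + ?D, q1, ?u, q2, v2)"
    using z en' hit d(5) by (auto simp: vec_upd_nth)
  have sg: "sgn ?v = 1" "sgn (?v - d) = - 1" using kv pos d(5) by (auto simp: sgn_if)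
  have "(\<Sum>i\<in>UNIV. sgn (?u $ i) * (q1 $ i / Q)) = (\<Sum>i\<in>UNIV. sgn (v1 $ i) * (q1 $ i / Q)) - 2"
    unfolding sum_vec_upd [where f="\<lambda>i x. sgn x * (q1 $ i / Q)"] using sg hit Q by simp
  then have ph: "phase_sum (Q, V, q1, v1, q2, v2) - phase_sum (Q, V + ?D, q1, ?u, q2, v2) = 2" by simp
  have W: "(V + ?D) / \<epsilon> + \<epsilon> * ((\<Sum>i\<in>UNIV. m1 $ i * ?u $ i * q1 $ i) / Q +
        (\<Sum>j\<in>UNIV. m2 $ j * v2 $ j * (1 - q2 $ j)) / (1 - Q)) =
     V / \<epsilon> + \<epsilon> * ((\<Sum>i\<in>UNIV. m1 $ i * v1 $ i * q1 $ i) / Q +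
        (\<Sum>j\<in>UNIV. m2 $ j * v2 $ j * (1 - q2 $ j)) / (1 - Q))"
  proof -
    have "(\<Sum>i\<in>UNIV. m1 $ i * ?u $ i * q1 $ i) = (\<Sum>i\<in>UNIV. m1 $ i * v1 $ i * q1 $ i) - ?m * d * Q"
      unfolding sum_vec_upd [where f="\<lambda>i x. m1 $ i * x * q1 $ i"] using hit by (simp add: algebra_simps)
    then have "(\<Sum>i\<in>UNIV. m1 $ i * ?u $ i * q1 $ i) / Q = (\<Sum>i\<in>UNIV. m1 $ i * v1 $ i * q1 $ i) / Q - ?m * d"
      using Q by (simp add: diff_divide_distrib)
    moreover have "?D / \<epsilon> = \<epsilon> * (?m * d)" using eps by (simp add: power2_eq_square)
    ultimately show ?thesis by (simp add: add_divide_distrib ring_distribs)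
  qed
  have D: "\<bar>?D\<bar> \<le> \<mu> * \<epsilon>\<^sup>2 * (4 * R)" using momentum_transfer_le m1 d(4) by blast
  have part: "\<bar>?D * (sgn v * y)\<bar> \<le> \<mu> * \<epsilon>\<^sup>2 * (4 * R)" if "\<bar>y\<bar> \<le> 1" for v y :: real
    unfolding abs_mult [of ?D]
    using D mult_left_mono [OF abs_sgn_mult_le_one [OF that, of v], of "\<bar>?D\<bar>"] by linarith
  have c1: "\<bar>(\<bar>?u $ i\<bar> - (V + ?D) * sgn (?u $ i) * (q1 $ i / Q)) - (\<bar>v1 $ i\<bar> - V * sgn (v1 $ i) * (q1 $ i / Q))\<bar>
    \<le> \<mu> * \<epsilon>\<^sup>2 * (4 * R)" for i
  proof (cases "i = j")
    case True
    \<comment> \<open>Outgoing minus incoming relative speed; \<open>d(3)\<close> makes it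
      vanish.\<close>
    have "(\<bar>?v - d\<bar> + (V + ?D)) - (?v - V) = d * (1 + ?m * \<epsilon>\<^sup>2) - 2 * (?v - V)"
      using d(5) pos by (simp add: algebra_simps)
    then have "(\<bar>?u $ i\<bar> - (V + ?D) * sgn (?u $ i) * (q1 $ i / Q)) - (\<bar>v1 $ i\<bar> - V * sgn (v1 $ i) * (q1 $ i / Q)) = 0"
      using True sg hit Q d(3) kv pos by (simp add: vec_upd_nth)
    then show ?thesis using D by linarith
  next
    case False
    then have "(\<bar>?u $ i\<bar> - (V + ?D) * sgn (?u $ i) * (q1 $ i / Q)) - (\<bar>v1 $ i\<bar> - V * sgn (v1 $ i) * (q1 $ i / Q))
       = - (?D * (sgn (v1 $ i) * (q1 $ i / Q)))" by (simp add: vec_upd_nth algebra_simps)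
    then show ?thesis using part [OF phase_bounds(1) [OF z]] by simp
  qed
  have c2: "\<bar>(\<bar>v2 $ i\<bar> - (V + ?D) * sgn (v2 $ i) * ((1 - q2 $ i) / (1 - Q))) - (\<bar>v2 $ i\<bar> - V * sgn (v2 $ i) * ((1 - q2 $ i) / (1 - Q)))\<bar>
    \<le> \<mu> * \<epsilon>\<^sup>2 * (4 * R)" for i
  proof -
    have "(\<bar>v2 $ i\<bar> - (V + ?D) * sgn (v2 $ i) * ((1 - q2 $ i) / (1 - Q))) - (\<bar>v2 $ i\<bar> - V * sgn (v2 $ i) * ((1 - q2 $ i) / (1 - Q)))
      = - (?D * (sgn (v2 $ i) * ((1 - q2 $ i) / (1 - Q))))" by (simp only: ring_distribs mult.assoc)
    then show ?thesis using part [OF phase_bounds(2) [OF z]] by simp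
  qed
  have "norm (corrected_slow \<epsilon> m1 m2 (Q, V + ?D, q1, ?u, q2, v2) - corrected_slow \<epsilon> m1 m2 (Q, V, q1, v1, q2, v2))
     \<le> n * (\<mu> * \<epsilon>\<^sup>2 * (4 * R))"
    unfolding corrected_slow.simps diff_Pair W
    by (rule order_trans [OF norm_slow_le])
       (simp only: vector_minus_component vec_lambda_beta diff_self abs_zero add_0_left,
        intro sum_components_le c1 c2)
  then show ?thesis unfolding resolves_def d(1,2) ph using adm by (simp add: mult_ac)
qed

text \<open>Mirror image of \<open>hit_left_resolves\<close>. The signs of the incoming and outgoing
  velocities are exchanged, which the minus sign in \<open>phase_sum\<close> compensates.\<close>

lemma hit_right_resolves:
  assumes z: "admissible (Q, V, q1, v1, q2, v2)" and hit: "q2 $ j = Q" "v2 $ j < V"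
  shows "resolves (Q, V, q1, v1, q2, v2)
    (Q, piston_out (1 / \<epsilon>\<^sup>2) (m2 $ j) V (v2 $ j), q1, v1,
     q2, vec_upd v2 j (gas_out (1 / \<epsilon>\<^sup>2) (m2 $ j) V (v2 $ j)))"
proof -
  let ?m = "m2 $ j" and ?v = "v2 $ j"
  have en: "energy \<epsilon> m1 m2 (Q, V, q1, v1, q2, v2) \<le> E" using z by simp
  note eb = energy_bounds [OF en]
  have Q: "0 < Q" "Q < 1" using z pos by auto
  have V: "\<bar>V\<bar> \<le> k / 16" using eb(1) eps by linarith
  have kv: "?v \<le> - k"
  proof -
    have "k \<le> \<bar>?v\<bar> \<or> k / 2 \<le> ?v" using z by auto
    then show ?thesis using V hit pos by linarith
  qed
  obtain d where d: "piston_out (1 / \<epsilon>\<^sup>2) ?m V ?v = V + ?m * \<epsilon>\<^sup>2 * d" "gas_out (1 / \<epsilon>\<^sup>2) ?m V ?v = ?v - d"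
    "d * (1 + ?m * \<epsilon>\<^sup>2) = 2 * (?v - V)" "\<bar>d\<bar> \<le> 4 * R" "k / 2 \<le> ?v - d"
    using collision_velocities [OF m2(1) m2(2) eb(1) eb(3), of j j] kv by metis
  let ?D = "?m * \<epsilon>\<^sup>2 * d"
  let ?u = "vec_upd v2 j (?v - d)"
  have e2: "\<epsilon>\<^sup>2 > 0" using eps by simp
  have "energy \<epsilon> m1 m2 (Q, V + ?D, q1, v1, q2, ?u) = energy \<epsilon> m1 m2 (Q, V, q1, v1, q2, v2)
    + (((V + ?D)\<^sup>2 - V\<^sup>2) / \<epsilon>\<^sup>2 + ?m * ((?v - d)\<^sup>2 - ?v\<^sup>2))"
    by (simp add: sum_vec_upd [where f="\<lambda>i x. m2 $ i * x\<^sup>2"] diff_divide_distrib right_diff_distrib)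
  moreover have "((V + ?D)\<^sup>2 - V\<^sup>2) / \<epsilon>\<^sup>2 = ?m * (2 * V * d + ?m * \<epsilon>\<^sup>2 * d\<^sup>2)"
    using eps by (simp add: power2_eq_square field_simps)
  moreover have "?m * (2 * V * d + ?m * \<epsilon>\<^sup>2 * d\<^sup>2) + ?m * ((?v - d)\<^sup>2 - ?v\<^sup>2)
    = ?m * d * (d * (1 + ?m * \<epsilon>\<^sup>2) - 2 * (?v - V))"
    by (simp add: power2_eq_square algebra_simps)
  ultimately have en': "energy \<epsilon> m1 m2 (Q, V + ?D, q1, v1, q2, ?u) \<le> E" using en d(3) by simp
  have adm: "admissible (Q, V + ?D, q1, v1, q2, ?u)"
    using z en' hit d(5) by (auto simp: vec_upd_nth)
  have sg: "sgn ?v = - 1" "sgn (?v - d) = 1" using kv pos d(5) by (auto simp: sgn_if)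
  have "(\<Sum>i\<in>UNIV. sgn (?u $ i) * ((1 - q2 $ i) / (1 - Q))) = (\<Sum>i\<in>UNIV. sgn (v2 $ i) * ((1 - q2 $ i) / (1 - Q))) + 2"
    unfolding sum_vec_upd [where f="\<lambda>i x. sgn x * ((1 - q2 $ i) / (1 - Q))"] sg hit using Q by simp
  then have ph: "phase_sum (Q, V, q1, v1, q2, v2) - phase_sum (Q, V + ?D, q1, v1, q2, ?u) = 2" by simp
  have W: "(V + ?D) / \<epsilon> + \<epsilon> * ((\<Sum>i\<in>UNIV. m1 $ i * v1 $ i * q1 $ i) / Q +
        (\<Sum>j\<in>UNIV. m2 $ j * ?u $ j * (1 - q2 $ j)) / (1 - Q)) =
     V / \<epsilon> + \<epsilon> * ((\<Sum>i\<in>UNIV. m1 $ i * v1 $ i * q1 $ i) / Q +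
        (\<Sum>j\<in>UNIV. m2 $ j * v2 $ j * (1 - q2 $ j)) / (1 - Q))"
  proof -
    have "(\<Sum>j\<in>UNIV. m2 $ j * ?u $ j * (1 - q2 $ j)) = (\<Sum>j\<in>UNIV. m2 $ j * v2 $ j * (1 - q2 $ j)) - ?m * d * (1 - Q)"
      unfolding sum_vec_upd [where f="\<lambda>i x. m2 $ i * x * (1 - q2 $ i)"] using hit by (simp add: algebra_simps)
    then have "(\<Sum>j\<in>UNIV. m2 $ j * ?u $ j * (1 - q2 $ j)) / (1 - Q)
        = (\<Sum>j\<in>UNIV. m2 $ j * v2 $ j * (1 - q2 $ j)) / (1 - Q) - ?m * d"
      using Q by (simp add: diff_divide_distrib)
    moreover have "?D / \<epsilon> = \<epsilon> * (?m * d)" using eps by (simp add: power2_eq_square)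
    ultimately show ?thesis by (simp add: add_divide_distrib ring_distribs)
  qed
  have D: "\<bar>?D\<bar> \<le> \<mu> * \<epsilon>\<^sup>2 * (4 * R)" using momentum_transfer_le m2 d(4) by blast
  have part: "\<bar>?D * (sgn v * y)\<bar> \<le> \<mu> * \<epsilon>\<^sup>2 * (4 * R)" if "\<bar>y\<bar> \<le> 1" for v y :: real
    unfolding abs_mult [of ?D]
    using D mult_left_mono [OF abs_sgn_mult_le_one [OF that, of v], of "\<bar>?D\<bar>"] by linarith
  have c1: "\<bar>(\<bar>v1 $ i\<bar> - (V + ?D) * sgn (v1 $ i) * (q1 $ i / Q)) - (\<bar>v1 $ i\<bar> - V * sgn (v1 $ i) * (q1 $ i / Q))\<bar>
    \<le> \<mu> * \<epsilon>\<^sup>2 * (4 * R)" for i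
  proof -
    have "(\<bar>v1 $ i\<bar> - (V + ?D) * sgn (v1 $ i) * (q1 $ i / Q)) - (\<bar>v1 $ i\<bar> - V * sgn (v1 $ i) * (q1 $ i / Q))
      = - (?D * (sgn (v1 $ i) * (q1 $ i / Q)))" by (simp only: ring_distribs mult.assoc)
    then show ?thesis using part [OF phase_bounds(1) [OF z]] by simp
  qed
  have c2: "\<bar>(\<bar>?u $ i\<bar> - (V + ?D) * sgn (?u $ i) * ((1 - q2 $ i) / (1 - Q))) - (\<bar>v2 $ i\<bar> - V * sgn (v2 $ i) * ((1 - q2 $ i) / (1 - Q)))\<bar>
    \<le> \<mu> * \<epsilon>\<^sup>2 * (4 * R)" for i
  proof (cases "i = j")
    case True
    have "(\<bar>?v - d\<bar> - (V + ?D)) - (V - ?v) = - (d * (1 + ?m * \<epsilon>\<^sup>2) - 2 * (?v - V))"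
      using d(5) pos by (simp add: algebra_simps)
    then have "(\<bar>?u $ i\<bar> - (V + ?D) * sgn (?u $ i) * ((1 - q2 $ i) / (1 - Q))) - (\<bar>v2 $ i\<bar> - V * sgn (v2 $ i) * ((1 - q2 $ i) / (1 - Q))) = 0"
      using True sg hit Q d(3) kv pos by (simp add: vec_upd_nth)
    then show ?thesis using D by linarith
  next
    case False
    then have "(\<bar>?u $ i\<bar> - (V + ?D) * sgn (?u $ i) * ((1 - q2 $ i) / (1 - Q))) - (\<bar>v2 $ i\<bar> - V * sgn (v2 $ i) * ((1 - q2 $ i) / (1 - Q)))
       = - (?D * (sgn (v2 $ i) * ((1 - q2 $ i) / (1 - Q))))" 
      by (simp only: vec_upd_nth if_False ring_distribs mult.assoc)
    then show ?thesis using part [OF phase_bounds(2) [OF z]] by simp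
  qed
  have "norm (corrected_slow \<epsilon> m1 m2 (Q, V + ?D, q1, v1, q2, ?u) - corrected_slow \<epsilon> m1 m2 (Q, V, q1, v1, q2, v2))
     \<le> n * (\<mu> * \<epsilon>\<^sup>2 * (4 * R))"
    unfolding corrected_slow.simps diff_Pair W
    by (rule order_trans [OF norm_slow_le])
       (simp only: vector_minus_component vec_lambda_beta diff_self abs_zero add_0_left,
        intro sum_components_le c1 c2)
  then show ?thesis unfolding resolves_def d(1,2) ph using adm by (simp add: mult_ac)
qed

lemma hit_piston_resolves:
  assumes "admissible z"
  shows "resolves z (hit_piston (1 / \<epsilon>\<^sup>2) m1 m2 i z)"
proof (cases z)
  case (fields Q V q1 v1 q2 v2)
  show ?thesis
  proof (cases i)
    case (Inl j)
    then show ?thesis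
      using hit_left_resolves [of Q V q1 v1 q2 v2 j] resolves_refl assms unfolding fields by auto
  next
    case (Inr j)
    then show ?thesis
      using hit_right_resolves [of Q V q1 v1 q2 v2 j] resolves_refl assms unfolding fields by auto
  qed
qed

text \<open>At the wall the weight of the particle is 0, which hides the sign of its velocity from
  \<open>corrected_slow\<close> and \<open>phase_sum\<close>, while \<open>energy\<close> is even in
  the velocities. A particle at the piston is not at a wall, as 0 < Q < 1, so the second disjuncts
  of \<open>admissible\<close> survive.\<close>

lemma reflect_walls_resolves:
  assumes "admissible z"
  shows "resolves z (reflect_walls z)"
proof (cases z)
  case (fields Q V q1 v1 q2 v2)
  let ?u1 = "\<chi> j. if q1 $ j = 0 \<and> v1 $ j < 0 then - (v1 $ j) else v1 $ j"
  let ?u2 = "\<chi> j. if q2 $ j = 1 \<and> v2 $ j > 0 then - (v2 $ j) else v2 $ j"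
  have z: "admissible (Q, V, q1, v1, q2, v2)" using assms fields by simp
  then have Q: "0 < Q" "Q < 1" using pos by auto
  have s: "\<bar>?u1 $ i\<bar> = \<bar>v1 $ i\<bar>" "\<bar>?u2 $ j\<bar> = \<bar>v2 $ j\<bar>" "(?u1 $ i)\<^sup>2 = (v1 $ i)\<^sup>2" "(?u2 $ j)\<^sup>2 = (v2 $ j)\<^sup>2" for i j
    by auto
  have q: "sgn (?u1 $ i) * (q1 $ i / Q) = sgn (v1 $ i) * (q1 $ i / Q)"
    "sgn (?u2 $ j) * ((1 - q2 $ j) / (1 - Q)) = sgn (v2 $ j) * ((1 - q2 $ j) / (1 - Q))"
    "m1 $ i * ?u1 $ i * q1 $ i = m1 $ i * v1 $ i * q1 $ i"
    "m2 $ j * ?u2 $ j * (1 - q2 $ j) = m2 $ j * v2 $ j * (1 - q2 $ j)" for i j by auto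
  have nz: "q1 $ i = Q \<Longrightarrow> ?u1 $ i = v1 $ i" "q2 $ j = Q \<Longrightarrow> ?u2 $ j = v2 $ j" for i j
    using Q by auto
  have en: "energy \<epsilon> m1 m2 (Q, V, q1, ?u1, q2, ?u2) = energy \<epsilon> m1 m2 (Q, V, q1, v1, q2, v2)"
    by (simp only: energy.simps s)
  have speed1: "k \<le> \<bar>?u1 $ i\<bar> \<or> q1 $ i = Q \<and> ?u1 $ i \<le> - k / 2" for i
  proof -
    have "k \<le> \<bar>v1 $ i\<bar> \<or> q1 $ i = Q \<and> v1 $ i \<le> - k / 2" using z by simp
    then show ?thesis by (rule disj_forward) (simp_all only: s nz)
  qed
  have speed2: "k \<le> \<bar>?u2 $ i\<bar> \<or> q2 $ i = Q \<and> k / 2 \<le> ?u2 $ i" for i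
  proof -
    have "k \<le> \<bar>v2 $ i\<bar> \<or> q2 $ i = Q \<and> k / 2 \<le> v2 $ i" using z by simp
    then show ?thesis by (rule disj_forward) (simp_all only: s nz)
  qed
  have "admissible (Q, V, q1, ?u1, q2, ?u2)"
    using z unfolding admissible.simps en by (intro conjI allI speed1 speed2) blast+
  moreover have "phase_sum (Q, V, q1, ?u1, q2, ?u2) = phase_sum (Q, V, q1, v1, q2, v2)"
    by (simp only: phase_sum.simps q)
  moreover have "corrected_slow \<epsilon> m1 m2 (Q, V, q1, ?u1, q2, ?u2) = corrected_slow \<epsilon> m1 m2 (Q, V, q1, v1, q2, v2)"
    by (simp only: corrected_slow.simps s q mult.assoc [of V])
  ultimately show ?thesis by (simp add: resolves_def fields)
qed

text \<open>The bounds in \<open>resolves\<close> telescope over all pairwise collisions, whatever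
  the number of rounds of \<open>collide\<close>.\<close>

lemma post_collision_resolves:
  assumes "admissible z" "post_collision (1 / \<epsilon>\<^sup>2) m1 m2 ord z z'"
  shows "resolves z z'"
proof -
  have fold: "resolves y (fold (hit_piston (1 / \<epsilon>\<^sup>2) m1 m2) l y)" if "admissible y" for y l
    using that
  proof (induction l arbitrary: y)
    case (Cons i l)
    have "resolves y (hit_piston (1 / \<epsilon>\<^sup>2) m1 m2 i y)" using Cons hit_piston_resolves by blast
    then show ?case
      unfolding fold.simps o_apply using Cons.IH resolves_admissible resolves_trans by blast
  qed (simp add: resolves_refl)
  have step: "resolves y (collide (1 / \<epsilon>\<^sup>2) m1 m2 ord y)" if "admissible y" for y
    unfolding collide_def
    using reflect_walls_resolves [OF that] fold resolves_admissible resolves_trans by blast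
  have "resolves z ((collide (1 / \<epsilon>\<^sup>2) m1 m2 ord ^^ i) z)" for i
  proof (induction i)
    case (Suc i)
    then show ?case
      unfolding funpow.simps o_apply using step resolves_admissible resolves_trans by blast
  qed (simp add: resolves_refl assms)
  then show ?thesis using assms(2) by (auto simp: post_collision_def)
qed

end

section \<open>Free flight\<close>

text \<open>The numerator v - V (q / Q) is, for nonzero v, the corrected speed times the sign of v;
  this is why the drift can be expressed by corrected speeds. With 1 - q and 1 - Q it serves the
  right particles.\<close>

lemma ratio_has_derivative:
  fixes q v Q V :: real
  assumes "Q \<noteq> 0"
  shows "((\<lambda>r. (q + r * v) / (Q + r * V)) has_real_derivative (v - V * (q / Q)) / Q) (at 0 within S)"
  using assms by (auto intro!: derivative_eq_intros simp: field_simps)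

text \<open>Projections in place of a pattern allow the limit rules for \<open>fst\<close> and
  \<open>snd\<close> to be applied to a convergent state; likewise in the next two lemmas.\<close>

lemma corrected_slow_alt:
  "corrected_slow \<epsilon> m1 m2 z =
     (let Q = fst z; V = fst (snd z); q1 = fst (snd (snd z)); v1 = fst (snd (snd (snd z)));
        q2 = fst (snd (snd (snd (snd z)))); v2 = snd (snd (snd (snd (snd z))))
      in (Q,
      V / \<epsilon> + \<epsilon> * ((\<Sum>j\<in>UNIV. m1 $ j * v1 $ j * q1 $ j) / Q +
        (\<Sum>j\<in>UNIV. m2 $ j * v2 $ j * (1 - q2 $ j)) / (1 - Q)),
      (\<chi> j. \<bar>v1 $ j\<bar> - V * sgn (v1 $ j) * (q1 $ j / Q)),
      (\<chi> j. \<bar>v2 $ j\<bar> - V * sgn (v2 $ j) * ((1 - q2 $ j) / (1 - Q)))))"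
  by (cases z) simp

lemma phase_sum_alt:
  "phase_sum z =
     (let Q = fst z; q1 = fst (snd (snd z)); v1 = fst (snd (snd (snd z)));
        q2 = fst (snd (snd (snd (snd z)))); v2 = snd (snd (snd (snd (snd z))))
      in (\<Sum>j\<in>UNIV. sgn (v1 $ j) * (q1 $ j / Q)) - (\<Sum>j\<in>UNIV. sgn (v2 $ j) * ((1 - q2 $ j) / (1 - Q))))"
  by (cases z) simp

lemma slow_vars_alt:
  "slow_vars \<epsilon> z = (fst z, fst (snd z) / \<epsilon>, \<chi> j. \<bar>fst (snd (snd (snd z))) $ j\<bar>,
     \<chi> j. \<bar>snd (snd (snd (snd (snd z)))) $ j\<bar>)"
  by (cases z) simp

lemma tendsto_slow_vars:
  assumes "(x \<longlongrightarrow> z) F" "\<epsilon> \<noteq> 0"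
  shows "((\<lambda>t. slow_vars \<epsilon> (x t)) \<longlongrightarrow> slow_vars \<epsilon> z) F"
  unfolding slow_vars_alt by (intro tendsto_intros assms)

lemma right_quotient_tendsto:
  fixes f :: "real \<Rightarrow> 'v::real_normed_vector"
  assumes "(f has_vector_derivative D) (at 0 within {0..\<delta>})" "\<delta> > 0"
  shows "((\<lambda>r. (f r - f 0) /\<^sub>R r) \<longlongrightarrow> D) (at_right 0)"
proof -
  have "((\<lambda>r. (1 / norm (r - 0)) *\<^sub>R (f r - (f 0 + (r - 0) *\<^sub>R D))) \<longlongrightarrow> 0) (at_right 0)"
    using assms unfolding has_vector_derivative_def has_derivative_within
    by (simp add: at_within_Icc_at_right)
  moreover have "\<forall>\<^sub>F r in at_right 0.
      (1 / norm (r - 0)) *\<^sub>R (f r - (f 0 + (r - 0) *\<^sub>R D)) = (f r - f 0) /\<^sub>R r - D"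
    using eventually_at_right_less [of "0 :: real"]
    by eventually_elim (simp add: divide_inverse algebra_simps)
  ultimately have "((\<lambda>r. (f r - f 0) /\<^sub>R r - D) \<longlongrightarrow> 0) (at_right 0)"
    by (simp add: tendsto_cong)
  then show ?thesis by (rule LIM_zero_cancel)
qed

context slow_piston
begin

text \<open>Admissible speeds are at least k / 2 and Q stays away from 0 and 1, so
  \<open>sgn\<close> and the quotients are continuous there.\<close>

lemma tendsto_corrected:
  assumes z: "admissible z" and x: "(x \<longlongrightarrow> z) F"
  shows "((\<lambda>t. corrected_slow \<epsilon> m1 m2 (x t)) \<longlongrightarrow> corrected_slow \<epsilon> m1 m2 z) F"
    and "((\<lambda>t. phase_sum (x t)) \<longlongrightarrow> phase_sum z) F"
proof -
  obtain Q V q1 v1 q2 v2 where f: "z = (Q, V, q1, v1, q2, v2)" by (cases z)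
  have Q: "Q \<noteq> 0" "1 - Q \<noteq> 0" using z pos unfolding f by auto
  have "v1 $ j \<noteq> 0" for j
  proof -
    have "k \<le> \<bar>v1 $ j\<bar> \<or> v1 $ j \<le> - k / 2" using z unfolding f by auto
    then show ?thesis using pos by auto
  qed
  moreover have "v2 $ j \<noteq> 0" for j
  proof -
    have "k \<le> \<bar>v2 $ j\<bar> \<or> k / 2 \<le> v2 $ j" using z unfolding f by auto
    then show ?thesis using pos by auto
  qed
  ultimately have v: "fst (snd (snd (snd z))) $ i \<noteq> 0" "snd (snd (snd (snd (snd z)))) $ j \<noteq> 0" for i j
    by (simp_all add: f)
  have Q': "fst z \<noteq> 0" "1 - fst z \<noteq> 0" using Q by (simp_all add: f)
  show "((\<lambda>t. corrected_slow \<epsilon> m1 m2 (x t)) \<longlongrightarrow> corrected_slow \<epsilon> m1 m2 z) F"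
    unfolding corrected_slow_alt Let_def using eps by (intro tendsto_intros x Q' v) simp
  show "((\<lambda>t. phase_sum (x t)) \<longlongrightarrow> phase_sum z) F"
    unfolding phase_sum_alt Let_def by (intro tendsto_intros x Q' v)
qed

lemma phase_sum_bound:
  assumes "admissible z"
  shows "\<bar>phase_sum z\<bar> \<le> n"
proof -
  obtain Q V q1 v1 q2 v2 where f: "z = (Q, V, q1, v1, q2, v2)" by (cases z)
  note b = phase_bounds [OF assms [unfolded f]]
  have "\<bar>phase_sum z\<bar> \<le> (\<Sum>j\<in>UNIV. \<bar>sgn (v1 $ j) * (q1 $ j / Q)\<bar>) + (\<Sum>j\<in>UNIV. \<bar>sgn (v2 $ j) * ((1 - q2 $ j) / (1 - Q))\<bar>)"
    unfolding f phase_sum.simps by (rule order_trans [OF abs_triangle_ineq4]) (intro add_mono sum_abs)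
  also have "\<dots> \<le> n * 1" by (intro sum_components_le abs_sgn_mult_le_one b)
  finally show ?thesis by simp
qed

text \<open>Each particle contributes at most \<epsilon> \<mu> R to the correction of W, and at most
  |V|, hence \<epsilon> R, to that of its own speed.\<close>

lemma corrected_slow_close:
  assumes "admissible z"
  shows "norm (corrected_slow \<epsilon> m1 m2 z - slow_vars \<epsilon> z) \<le> n * (\<mu> + 1) * R * \<epsilon>"
proof -
  obtain Q V q1 v1 q2 v2 where f: "z = (Q, V, q1, v1, q2, v2)" by (cases z)
  note b = phase_bounds [OF assms [unfolded f]]
  have en: "energy \<epsilon> m1 m2 (Q, V, q1, v1, q2, v2) \<le> E" using assms f by simp
  note eb = energy_bounds [OF en]
  have mv: "\<bar>m * v * y\<bar> \<le> \<mu> * R" if "0 < m" "m \<le> \<mu>" "\<bar>v\<bar> \<le> R" "\<bar>y\<bar> \<le> 1" for m v y :: real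
    using mult_mono [OF mult_mono [of "\<bar>m\<bar>" \<mu> "\<bar>v\<bar>" R], of "\<bar>y\<bar>" 1] that pos mu_pos by (simp add: abs_mult)
  have "\<bar>(\<Sum>j\<in>UNIV. m1 $ j * v1 $ j * q1 $ j) / Q + (\<Sum>j\<in>UNIV. m2 $ j * v2 $ j * (1 - q2 $ j)) / (1 - Q)\<bar>
    \<le> (\<Sum>j\<in>UNIV. \<bar>m1 $ j * v1 $ j * (q1 $ j / Q)\<bar>) + (\<Sum>j\<in>UNIV. \<bar>m2 $ j * v2 $ j * ((1 - q2 $ j) / (1 - Q))\<bar>)"
    unfolding sum_divide_distrib times_divide_eq_right
    by (rule order_trans [OF abs_triangle_ineq]) (intro add_mono sum_abs)
  also have "\<dots> \<le> n * (\<mu> * R)" by (intro sum_components_le mv b eb m1 m2)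
  finally have W: "\<bar>\<epsilon> * ((\<Sum>j\<in>UNIV. m1 $ j * v1 $ j * q1 $ j) / Q + (\<Sum>j\<in>UNIV. m2 $ j * v2 $ j * (1 - q2 $ j)) / (1 - Q))\<bar>
    \<le> \<epsilon> * (n * (\<mu> * R))" using eps by (simp add: abs_mult)
  have part: "\<bar>- (V * (sgn v * y))\<bar> \<le> \<epsilon> * R" if "\<bar>y\<bar> \<le> 1" for v y :: real
    unfolding abs_minus_cancel abs_mult [of V]
    using eb(1) mult_left_mono [OF abs_sgn_mult_le_one [OF that, of v], of "\<bar>V\<bar>"] by linarith
  have s: "(\<Sum>j\<in>UNIV. \<bar>- (V * (sgn (v1 $ j) * (q1 $ j / Q)))\<bar>) +
      (\<Sum>j\<in>UNIV. \<bar>- (V * (sgn (v2 $ j) * ((1 - q2 $ j) / (1 - Q))))\<bar>) \<le> n * (\<epsilon> * R)"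
    by (intro sum_components_le part b)
  have "norm (corrected_slow \<epsilon> m1 m2 z - slow_vars \<epsilon> z) \<le>
    \<bar>\<epsilon> * ((\<Sum>j\<in>UNIV. m1 $ j * v1 $ j * q1 $ j) / Q + (\<Sum>j\<in>UNIV. m2 $ j * v2 $ j * (1 - q2 $ j)) / (1 - Q))\<bar> +
    (\<Sum>j\<in>UNIV. \<bar>- (V * (sgn (v1 $ j) * (q1 $ j / Q)))\<bar>) +
      (\<Sum>j\<in>UNIV. \<bar>- (V * (sgn (v2 $ j) * ((1 - q2 $ j) / (1 - Q))))\<bar>)"
    unfolding f corrected_slow.simps slow_vars.simps diff_Pair
    by (rule order_trans [OF norm_slow_le]) (simp add: mult.assoc)
  also have "\<dots> \<le> \<epsilon> * (n * (\<mu> * R)) + n * (\<epsilon> * R)" using W s by linarith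
  also have "\<dots> = n * (\<mu> + 1) * R * \<epsilon>" by (simp add: algebra_simps)
  finally show ?thesis .
qed

text \<open>The drift is exact. For a left particle with weight y = q / Q and corrected speed p,
  multiplying y' = sgn(v) p / Q by m v gives m |v| p / Q, and by - V sgn(v) gives - V p / Q; the
  right side is analogous. In the second claim, 2 R bounds |v - V y|.\<close>

lemma free_flight_derivative:
  assumes z: "admissible (Q, V, q1, v1, q2, v2)"
  defines "p1 \<equiv> (\<chi> j. \<bar>v1 $ j\<bar> - V * sgn (v1 $ j) * (q1 $ j / Q))"
    and "p2 \<equiv> (\<chi> j. \<bar>v2 $ j\<bar> - V * sgn (v2 $ j) * ((1 - q2 $ j) / (1 - Q)))"
    and "z \<equiv> (Q, V, q1, v1, q2, v2)"
  shows "((\<lambda>r. (corrected_slow \<epsilon> m1 m2 (free_flight r z) - corrected_slow \<epsilon> m1 m2 z) /\<^sub>R r) \<longlongrightarrow>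
     \<epsilon> *\<^sub>R split_field m1 m2 Q (V / \<epsilon>) (\<chi> j. \<bar>v1 $ j\<bar>) (\<chi> j. \<bar>v2 $ j\<bar>) p1 p2) (at_right 0)"
    and "\<exists>D. ((\<lambda>r. (phase_sum (free_flight r z) - phase_sum z) / r) \<longlongrightarrow> D) (at_right 0) \<and>
      \<bar>D\<bar> \<le> n * (2 * R / a)"
proof -
  have Q: "Q \<noteq> 0" "1 - Q \<noteq> 0" "a \<le> Q" "a \<le> 1 - Q" using z pos by auto
  have en: "energy \<epsilon> m1 m2 (Q, V, q1, v1, q2, v2) \<le> E" using z by simp
  note eb = energy_bounds [OF en] and b = phase_bounds [OF z]
  define \<rho>1 where "\<rho>1 = (\<lambda>j r. (q1 $ j + r * v1 $ j) / (Q + r * V))"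
  define \<rho>2 where "\<rho>2 = (\<lambda>j r. (1 - (q2 $ j + r * v2 $ j)) / (1 - (Q + r * V)))"
  define D1 where "D1 = (\<lambda>j. (v1 $ j - V * (q1 $ j / Q)) / Q)"
  define D2 where "D2 = (\<lambda>j. - (v2 $ j - V * ((1 - q2 $ j) / (1 - Q))) / (1 - Q))"
  have \<rho>0: "\<rho>1 j 0 = q1 $ j / Q" "\<rho>2 i 0 = (1 - q2 $ i) / (1 - Q)" for i j
    by (simp_all add: \<rho>1_def \<rho>2_def)
  have d1: "(\<rho>1 j has_real_derivative D1 j) (at 0 within {0<..})" for j
    unfolding \<rho>1_def D1_def using Q by (intro ratio_has_derivative)
  have d2: "(\<rho>2 j has_real_derivative D2 j) (at 0 within {0<..})" for j
  proof -
    have "\<rho>2 j = (\<lambda>r. (1 - q2 $ j + r * - (v2 $ j)) / (1 - Q + r * - V))"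
      by (simp add: \<rho>2_def algebra_simps)
    moreover have "D2 j = (- (v2 $ j) - - V * ((1 - q2 $ j) / (1 - Q))) / (1 - Q)" by (simp add: D2_def)
    ultimately show ?thesis using ratio_has_derivative [OF Q(2)] by presburger
  qed
  have quot: "((\<lambda>r. (f r - f 0) / r) \<longlongrightarrow> D) (at_right 0)"
    if "(f has_real_derivative D) (at 0 within {0<..})" for f D
    using that by (simp add: has_field_derivative_iff)
  have flight: "corrected_slow \<epsilon> m1 m2 (free_flight r z) =
     (Q + r * V, V / \<epsilon> + \<epsilon> * ((\<Sum>j\<in>UNIV. m1 $ j * v1 $ j * \<rho>1 j r) + (\<Sum>j\<in>UNIV. m2 $ j * v2 $ j * \<rho>2 j r)),
      (\<chi> j. \<bar>v1 $ j\<bar> - V * sgn (v1 $ j) * \<rho>1 j r), (\<chi> j. \<bar>v2 $ j\<bar> - V * sgn (v2 $ j) * \<rho>2 j r))" for r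
    by (simp add: z_def \<rho>1_def \<rho>2_def sum_divide_distrib)
  have flight0: "corrected_slow \<epsilon> m1 m2 z = corrected_slow \<epsilon> m1 m2 (free_flight 0 z)"
    by (simp add: z_def)
  have pv: "\<bar>v\<bar> * (\<bar>v\<bar> - V * sgn v * y) = v * (v - V * y)" "\<bar>v\<bar> - V * sgn v * y = sgn v * (v - V * y)"
    for v y :: real by (auto simp: sgn_if abs_if algebra_simps)
  have "((\<lambda>r. ((Q + r * V) - (Q + 0 * V)) / r) \<longlongrightarrow> V) (at_right 0)"
    by (rule quot) (auto intro!: derivative_eq_intros)
  moreover have "((\<lambda>r. ((V / \<epsilon> + \<epsilon> * ((\<Sum>j\<in>UNIV. m1 $ j * v1 $ j * \<rho>1 j r) + (\<Sum>j\<in>UNIV. m2 $ j * v2 $ j * \<rho>2 j r)))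
      - (V / \<epsilon> + \<epsilon> * ((\<Sum>j\<in>UNIV. m1 $ j * v1 $ j * \<rho>1 j 0) + (\<Sum>j\<in>UNIV. m2 $ j * v2 $ j * \<rho>2 j 0)))) / r)
      \<longlongrightarrow> \<epsilon> * ((\<Sum>j\<in>UNIV. m1 $ j * v1 $ j * D1 j) + (\<Sum>j\<in>UNIV. m2 $ j * v2 $ j * D2 j))) (at_right 0)"
    by (rule quot) (auto intro!: derivative_eq_intros d1 d2 simp: mult_ac)
  moreover have "((\<lambda>r. ((\<bar>v1 $ j\<bar> - V * sgn (v1 $ j) * \<rho>1 j r) - (\<bar>v1 $ j\<bar> - V * sgn (v1 $ j) * \<rho>1 j 0)) / r)
      \<longlongrightarrow> - (V * sgn (v1 $ j) * D1 j)) (at_right 0)" for j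
    by (rule quot) (auto intro!: derivative_eq_intros d1 simp: mult_ac)
  moreover have "((\<lambda>r. ((\<bar>v2 $ j\<bar> - V * sgn (v2 $ j) * \<rho>2 j r) - (\<bar>v2 $ j\<bar> - V * sgn (v2 $ j) * \<rho>2 j 0)) / r)
      \<longlongrightarrow> - (V * sgn (v2 $ j) * D2 j)) (at_right 0)" for j
    by (rule quot) (auto intro!: derivative_eq_intros d2 simp: mult_ac)
  ultimately have "((\<lambda>r. (((Q + r * V) - (Q + 0 * V)) / r,
      ((V / \<epsilon> + \<epsilon> * ((\<Sum>j\<in>UNIV. m1 $ j * v1 $ j * \<rho>1 j r) + (\<Sum>j\<in>UNIV. m2 $ j * v2 $ j * \<rho>2 j r)))
      - (V / \<epsilon> + \<epsilon> * ((\<Sum>j\<in>UNIV. m1 $ j * v1 $ j * \<rho>1 j 0) + (\<Sum>j\<in>UNIV. m2 $ j * v2 $ j * \<rho>2 j 0)))) / r,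
      \<chi> j. ((\<bar>v1 $ j\<bar> - V * sgn (v1 $ j) * \<rho>1 j r) - (\<bar>v1 $ j\<bar> - V * sgn (v1 $ j) * \<rho>1 j 0)) / r,
      \<chi> j. ((\<bar>v2 $ j\<bar> - V * sgn (v2 $ j) * \<rho>2 j r) - (\<bar>v2 $ j\<bar> - V * sgn (v2 $ j) * \<rho>2 j 0)) / r))
      \<longlongrightarrow> (V, \<epsilon> * ((\<Sum>j\<in>UNIV. m1 $ j * v1 $ j * D1 j) + (\<Sum>j\<in>UNIV. m2 $ j * v2 $ j * D2 j)),
        \<chi> j. - (V * sgn (v1 $ j) * D1 j), \<chi> j. - (V * sgn (v2 $ j) * D2 j))) (at_right 0)"
    by (intro tendsto_Pair tendsto_vec_lambda)
  also have "(\<lambda>r. (((Q + r * V) - (Q + 0 * V)) / r,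
      ((V / \<epsilon> + \<epsilon> * ((\<Sum>j\<in>UNIV. m1 $ j * v1 $ j * \<rho>1 j r) + (\<Sum>j\<in>UNIV. m2 $ j * v2 $ j * \<rho>2 j r)))
      - (V / \<epsilon> + \<epsilon> * ((\<Sum>j\<in>UNIV. m1 $ j * v1 $ j * \<rho>1 j 0) + (\<Sum>j\<in>UNIV. m2 $ j * v2 $ j * \<rho>2 j 0)))) / r,
      \<chi> j. ((\<bar>v1 $ j\<bar> - V * sgn (v1 $ j) * \<rho>1 j r) - (\<bar>v1 $ j\<bar> - V * sgn (v1 $ j) * \<rho>1 j 0)) / r,
      \<chi> j. ((\<bar>v2 $ j\<bar> - V * sgn (v2 $ j) * \<rho>2 j r) - (\<bar>v2 $ j\<bar> - V * sgn (v2 $ j) * \<rho>2 j 0)) / r))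
     = (\<lambda>r. (corrected_slow \<epsilon> m1 m2 (free_flight r z) - corrected_slow \<epsilon> m1 m2 z) /\<^sub>R r)"
    unfolding flight0 flight diff_Pair scaleR_Pair
    by (rule ext) (simp only: vec_eq_iff vector_minus_component vector_scaleR_component vec_lambda_beta
        prod.inject divide_inverse real_scaleR_def mult.commute [of "inverse _"], simp)
  also have "(V, \<epsilon> * ((\<Sum>j\<in>UNIV. m1 $ j * v1 $ j * D1 j) + (\<Sum>j\<in>UNIV. m2 $ j * v2 $ j * D2 j)),
        \<chi> j. - (V * sgn (v1 $ j) * D1 j), \<chi> j. - (V * sgn (v2 $ j) * D2 j)) =
     \<epsilon> *\<^sub>R split_field m1 m2 Q (V / \<epsilon>) (\<chi> j. \<bar>v1 $ j\<bar>) (\<chi> j. \<bar>v2 $ j\<bar>) p1 p2"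
  proof -
    have cancel: "\<epsilon> * (p * (V / \<epsilon>) / c) = V * p / c" for p c :: real using eps by simp
    have "m1 $ j * v1 $ j * D1 j = m1 $ j * (\<bar>v1 $ j\<bar> * p1 $ j) / Q" for j
      unfolding D1_def p1_def vec_lambda_beta pv(1) by simp
    moreover have "m2 $ j * v2 $ j * D2 j = - (m2 $ j * (\<bar>v2 $ j\<bar> * p2 $ j) / (1 - Q))" for j
      unfolding D2_def p2_def vec_lambda_beta pv(1)
      by (simp only: times_divide_eq_right minus_divide_left mult_minus_right mult.assoc)
    moreover have "V * sgn (v1 $ j) * D1 j = \<epsilon> * (p1 $ j * (V / \<epsilon>) / Q)" for j
      unfolding D1_def p1_def vec_lambda_beta pv(2) cancel by simp
    moreover have "- (V * sgn (v2 $ j) * D2 j) = \<epsilon> * (p2 $ j * (V / \<epsilon>) / (1 - Q))" for j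
      unfolding D2_def p2_def vec_lambda_beta pv(2) cancel
      by (simp only: times_divide_eq_right minus_divide_left mult_minus_right minus_minus mult.assoc)
    ultimately show ?thesis
      using eps by (simp add: split_field_def vec_eq_iff sum_divide_distrib sum_negf)
  qed
  finally show "((\<lambda>r. (corrected_slow \<epsilon> m1 m2 (free_flight r z) - corrected_slow \<epsilon> m1 m2 z) /\<^sub>R r) \<longlongrightarrow>
     \<epsilon> *\<^sub>R split_field m1 m2 Q (V / \<epsilon>) (\<chi> j. \<bar>v1 $ j\<bar>) (\<chi> j. \<bar>v2 $ j\<bar>) p1 p2) (at_right 0)" .
  let ?D = "(\<Sum>j\<in>UNIV. sgn (v1 $ j) * D1 j) - (\<Sum>j\<in>UNIV. sgn (v2 $ j) * D2 j)"
  have phase: "phase_sum (free_flight r z) = (\<Sum>j\<in>UNIV. sgn (v1 $ j) * \<rho>1 j r) - (\<Sum>j\<in>UNIV. sgn (v2 $ j) * \<rho>2 j r)" for r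
    by (simp add: z_def \<rho>1_def \<rho>2_def)
  have phase0: "phase_sum z = phase_sum (free_flight 0 z)" by (simp add: z_def)
  have "((\<lambda>r. (phase_sum (free_flight r z) - phase_sum z) / r) \<longlongrightarrow> ?D) (at_right 0)"
    unfolding phase0 phase by (rule quot) (auto intro!: derivative_eq_intros d1 d2 simp: mult_ac)
  moreover have "\<bar>?D\<bar> \<le> n * (2 * R / a)"
  proof -
    have VR: "\<bar>V\<bar> \<le> R" using eb(1) eps pos mult_right_mono [of \<epsilon> 1 R] by linarith
    have est: "\<bar>sgn w * (u / x)\<bar> \<le> 2 * R / a" if "\<bar>u\<bar> \<le> 2 * R" "a \<le> x" for w u x :: real
    proof -
      have "\<bar>sgn w * (u / x)\<bar> \<le> \<bar>u / x\<bar>" by (simp add: abs_mult sgn_if)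
      also have "\<dots> \<le> 2 * R / a" using that pos by (simp add: frac_le)
      finally show ?thesis .
    qed
    have num: "\<bar>v - V * y\<bar> \<le> 2 * R" if "\<bar>v\<bar> \<le> R" "\<bar>y\<bar> \<le> 1" for v y :: real
      using mult_mono [OF VR that(2)] that VR pos abs_triangle_ineq4 [of v "V * y"] by (simp add: abs_mult)
    have "\<bar>?D\<bar> \<le> (\<Sum>j\<in>UNIV. \<bar>sgn (v1 $ j) * D1 j\<bar>) + (\<Sum>j\<in>UNIV. \<bar>sgn (v2 $ j) * D2 j\<bar>)"
      by (rule order_trans [OF abs_triangle_ineq4]) (intro add_mono sum_abs)
    also have "\<dots> \<le> n * (2 * R / a)"
      unfolding D1_def D2_def
      by (intro sum_components_le est) (simp_all only: abs_minus_cancel, (rule num eb b Q)+)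
    finally show ?thesis .
  qed
  ultimately show "\<exists>D. ((\<lambda>r. (phase_sum (free_flight r z) - phase_sum z) / r) \<longlongrightarrow> D) (at_right 0) \<and>
      \<bar>D\<bar> \<le> n * (2 * R / a)" by blast
qed

section \<open>The averaging estimate\<close>

text \<open>By the triangle inequality the distance grows no faster than the two drifts separate.
  The limits of the difference quotients are bounded by these rates only weakly; the added
  \<epsilon>^2 makes the bound strict, hence valid for all small \<open>r\<close>, without changing
  the order of the error.\<close>

lemma free_flight_growth:
  fixes g :: "real \<Rightarrow> ('a, 'b) slow"
  assumes z: "admissible z"
    and g: "((\<lambda>r. (g r - g 0) /\<^sub>R r) \<longlongrightarrow> \<epsilon> *\<^sub>R averaged_field m1 m2 (g 0)) (at_right 0)"
    and g0: "g 0 = (Q', W', s1', s2')"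
    and box: "a \<le> Q'" "Q' \<le> 1 - a" "\<bar>W'\<bar> \<le> R" "\<And>j. \<bar>s1' $ j\<bar> \<le> R" "\<And>j. \<bar>s2' $ j\<bar> \<le> R"
    and c: "c \<ge> 0"
  defines "D \<equiv> norm (corrected_slow \<epsilon> m1 m2 z - g 0)"
  shows "\<forall>\<^sub>F r in at_right 0.
    norm (corrected_slow \<epsilon> m1 m2 (free_flight r z) - g r) + c * phase_sum (free_flight r z)
    \<le> D + c * phase_sum z
      + r * (\<epsilon> * field_lipschitz m1 m2 a (2 * R) * (D + n * (\<mu> + 1) * R * \<epsilon>) + c * (n * (2 * R / a)) + \<epsilon>\<^sup>2)"
proof -
  obtain Q V q1 v1 q2 v2 where f: "z = (Q, V, q1, v1, q2, v2)" by (cases z)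
  define p1 where "p1 = (\<chi> j. \<bar>v1 $ j\<bar> - V * sgn (v1 $ j) * (q1 $ j / Q))"
  define p2 where "p2 = (\<chi> j. \<bar>v2 $ j\<bar> - V * sgn (v2 $ j) * ((1 - q2 $ j) / (1 - Q)))"
  define F where "F = split_field m1 m2 Q (V / \<epsilon>) (\<chi> j. \<bar>v1 $ j\<bar>) (\<chi> j. \<bar>v2 $ j\<bar>) p1 p2"
  define H where "H = averaged_field m1 m2 (g 0)"
  define L where "L = field_lipschitz m1 m2 a (2 * R)"
  \<comment> \<open>Bounds the distance of \<open>g 0\<close> from both the corrected and the
    uncorrected slow variables.\<close>
  define \<delta> where "\<delta> = D + n * (\<mu> + 1) * R * \<epsilon>"
  note z' = z [unfolded f]
  have en: "energy \<epsilon> m1 m2 (Q, V, q1, v1, q2, v2) \<le> E" using z' by simp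
  note eb = energy_bounds [OF en] and b = phase_bounds [OF z']
  have Q: "a \<le> Q" "Q \<le> 1 - a" using z' by auto
  have VR: "\<bar>V\<bar> \<le> R" using eb(1) eps pos mult_right_mono [of \<epsilon> 1 R] by linarith
  have WR: "\<bar>V / \<epsilon>\<bar> \<le> R" using eb(1) eps by (simp add: divide_le_eq mult.commute)
  \<comment> \<open>A corrected speed can exceed R by |V|, hence \<open>2 * R\<close> in the
    Lipschitz constant.\<close>
  have pR: "\<bar>\<bar>v\<bar> - V * sgn v * y\<bar> \<le> 2 * R" if "\<bar>v\<bar> \<le> R" "\<bar>y\<bar> \<le> 1" for v y :: real
  proof -
    have "\<bar>V * (sgn v * y)\<bar> \<le> R * 1"
      unfolding abs_mult [of V] using VR abs_sgn_mult_le_one [OF that(2), of v] pos by (intro mult_mono) auto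
    then show ?thesis using that(1) unfolding mult.assoc by linarith
  qed
  have C1: "n * (\<mu> + 1) * R * \<epsilon> \<ge> 0" using n_ge_1 mu_pos pos eps by simp
  have slow: "norm (slow_vars \<epsilon> z - g 0) \<le> \<delta>"
    using norm_triangle_ineq [of "slow_vars \<epsilon> z - corrected_slow \<epsilon> m1 m2 z" "corrected_slow \<epsilon> m1 m2 z - g 0"]
      corrected_slow_close [OF z] by (simp add: \<delta>_def D_def norm_minus_commute)
  have corr: "norm (corrected_slow \<epsilon> m1 m2 z - g 0) \<le> \<delta>" using C1 by (simp add: \<delta>_def D_def)
  note sl = slow_component_le_norm [THEN order_trans, OF slow [unfolded f g0 slow_vars.simps diff_Pair]]
  note co = slow_component_le_norm [THEN order_trans, OF corr [unfolded f g0 corrected_slow.simps diff_Pair]]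
  have FH: "norm (F - H) \<le> L * \<delta>"
    unfolding F_def H_def L_def g0 averaged_field_eq_split
  proof (rule split_field_lipschitz)
    show "\<bar>Q - Q'\<bar> \<le> \<delta>" "\<bar>V / \<epsilon> - W'\<bar> \<le> \<delta>" using sl(1,2) by auto
    show "\<bar>(\<chi> j. \<bar>v1 $ j\<bar>) $ j - s1' $ j\<bar> \<le> \<delta> \<and> \<bar>p1 $ j - s1' $ j\<bar> \<le> \<delta>" for j
      using sl(3) [of j] co(3) [of j] by (simp add: p1_def)
    show "\<bar>(\<chi> j. \<bar>v2 $ j\<bar>) $ j - s2' $ j\<bar> \<le> \<delta> \<and> \<bar>p2 $ j - s2' $ j\<bar> \<le> \<delta>" for j
      using sl(4) [of j] co(4) [of j] by (simp add: p2_def)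
    show "\<bar>(\<chi> j. \<bar>v1 $ j\<bar>) $ j\<bar> \<le> 2 * R \<and> \<bar>s1' $ j\<bar> \<le> 2 * R \<and> \<bar>p1 $ j\<bar> \<le> 2 * R" for j
      using eb(2) [of j] box(4) [of j] pos pR [OF eb(2) b(1), of j j] by (simp add: p1_def)
    show "\<bar>(\<chi> j. \<bar>v2 $ j\<bar>) $ j\<bar> \<le> 2 * R \<and> \<bar>s2' $ j\<bar> \<le> 2 * R \<and> \<bar>p2 $ j\<bar> \<le> 2 * R" for j
      using eb(3) [of j] box(5) [of j] pos pR [OF eb(3) b(2), of j j] by (simp add: p2_def)
  qed (use pos Q box WR in auto)
  define u where "u = (\<lambda>r. corrected_slow \<epsilon> m1 m2 (free_flight r z) - g r)"
  have free_flight_0: "free_flight 0 z = z" by (simp add: f)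
  have u0: "u 0 = corrected_slow \<epsilon> m1 m2 z - g 0" by (simp add: u_def f)
  have "((\<lambda>r. (corrected_slow \<epsilon> m1 m2 (free_flight r z) - corrected_slow \<epsilon> m1 m2 z) /\<^sub>R r
      - (g r - g 0) /\<^sub>R r) \<longlongrightarrow> \<epsilon> *\<^sub>R F - \<epsilon> *\<^sub>R H) (at_right 0)"
    using free_flight_derivative(1) [OF z'] g unfolding f F_def H_def p1_def p2_def by (rule tendsto_diff)
  moreover have "(b - b') /\<^sub>R r - (d - d') /\<^sub>R r = ((b - d) - (b' - d')) /\<^sub>R r"
    for b b' d d' :: "('a, 'b) slow" and r :: real by (simp add: algebra_simps)
  ultimately have u: "((\<lambda>r. (u r - u 0) /\<^sub>R r) \<longlongrightarrow> \<epsilon> *\<^sub>R (F - H)) (at_right 0)"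
    unfolding u_def free_flight_0 scaleR_diff_right by (simp only:)
  obtain P where P: "((\<lambda>r. (phase_sum (free_flight r z) - phase_sum z) / r) \<longlongrightarrow> P) (at_right 0)"
    "\<bar>P\<bar> \<le> n * (2 * R / a)"
    using free_flight_derivative(2) [OF z'] unfolding f by blast
  let ?s = "\<epsilon> * L * \<delta> + c * (n * (2 * R / a)) + \<epsilon>\<^sup>2"
  have "((\<lambda>r. norm ((u r - u 0) /\<^sub>R r) + c * ((phase_sum (free_flight r z) - phase_sum z) / r))
      \<longlongrightarrow> norm (\<epsilon> *\<^sub>R (F - H)) + c * P) (at_right 0)"
    by (intro tendsto_intros u P)
  moreover have "norm (\<epsilon> *\<^sub>R (F - H)) + c * P < ?s"
  proof -
    have "norm (\<epsilon> *\<^sub>R (F - H)) \<le> \<epsilon> * L * \<delta>" using FH eps by (simp add: mult.assoc)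
    moreover have "c * P \<le> c * (n * (2 * R / a))" using P(2) c by (intro mult_left_mono) auto
    moreover have "\<epsilon>\<^sup>2 > 0" using eps by simp
    ultimately show ?thesis by linarith
  qed
  ultimately have "\<forall>\<^sub>F r in at_right 0.
      norm ((u r - u 0) /\<^sub>R r) + c * ((phase_sum (free_flight r z) - phase_sum z) / r) < ?s"
    by (rule order_tendstoD)
  then have "\<forall>\<^sub>F r in at_right 0.
      norm (u r) + c * phase_sum (free_flight r z) \<le> norm (u 0) + c * phase_sum z + r * ?s"
    using eventually_at_right_less [of "0 :: real"]
  proof eventually_elim
    case (elim r)
    have "norm (u r) \<le> norm (u 0) + norm (u r - u 0)" by (rule norm_triangle_sub)
    moreover have "norm (u r - u 0) = r * norm ((u r - u 0) /\<^sub>R r)" using elim by simp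
    moreover have "c * phase_sum (free_flight r z) - c * phase_sum z
      = r * (c * ((phase_sum (free_flight r z) - phase_sum z) / r))"
      using elim(2) by (simp add: field_simps)
    moreover have "r * norm ((u r - u 0) /\<^sub>R r) + r * (c * ((phase_sum (free_flight r z) - phase_sum z) / r)) \<le> r * ?s"
      using elim mult_left_mono [OF less_imp_le [OF elim(1)], of r] by (simp only: distrib_left)
    ultimately show ?case by linarith
  qed
  then show ?thesis unfolding u0 by (simp add: u_def D_def L_def \<delta>_def)
qed

text \<open>The rate \<epsilon> L acting for a time of at most T / \<epsilon> gives exp(L T), and
  the inhomogeneity \<epsilon>^2 C2 divided by this rate is of order \<epsilon>. \<open>C2\<close>
  collects the cost of passing from the distance to \<open>G\<close> and to uncorrected variables,
  the growth of the phases, and the slack of \<open>free_flight_growth\<close>. \<open>box\<close>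
  stops before \<tau> because right derivatives are taken only at earlier times.\<close>

lemma averaging_estimate:
  fixes x :: "real \<Rightarrow> ('a, 'b) state" and h :: "real \<Rightarrow> ('a, 'b) slow"
  assumes traj: "piston_trajectory (1 / \<epsilon>\<^sup>2) m1 m2 ord (S / \<epsilon>) x"
    and sol: "averaged_solution m1 m2 S h" and h0: "h 0 = slow_vars \<epsilon> (x 0)"
    and \<tau>: "0 \<le> \<tau>" "\<tau> \<le> S" "\<tau> \<le> T"
    and adm: "\<And>t. 0 \<le> t \<Longrightarrow> t \<le> \<tau> / \<epsilon> \<Longrightarrow> admissible (x t)"
    and box: "\<And>t Q W s1 s2. 0 \<le> t \<Longrightarrow> t < \<tau> \<Longrightarrow> h t = (Q, W, s1, s2) \<Longrightarrow>
      a \<le> Q \<and> Q \<le> 1 - a \<and> \<bar>W\<bar> \<le> R \<and> (\<forall>j. \<bar>s1 $ j\<bar> \<le> R) \<and> (\<forall>j. \<bar>s2 $ j\<bar> \<le> R)"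
  defines "L \<equiv> field_lipschitz m1 m2 a (2 * R)"
    and "C1 \<equiv> n * (\<mu> + 1) * R" and "c \<equiv> 2 * n * \<mu> * R"
  defines "C2 \<equiv> L * (c * n + C1) + c * n * (2 * R / a) + 1"
  shows "norm (slow_vars \<epsilon> (x (\<tau> / \<epsilon>)) - h \<tau>) \<le> (C1 + c * n + (C1 + c * n + C2 / L) * exp (L * T)) * \<epsilon>"
proof -
  have L: "L > 0" unfolding L_def by (rule field_lipschitz_pos)
  have nn: "C1 \<ge> 0" "c \<ge> 0" "n \<ge> 0" using n_ge_1 mu_pos pos by (auto simp: C1_def c_def)
  have C2: "C2 \<ge> 0" unfolding C2_def using L nn pos by (intro add_nonneg_nonneg mult_nonneg_nonneg) auto
  have e2: "\<epsilon>\<^sup>2 \<le> \<epsilon>" "\<epsilon>\<^sup>2 \<ge> 0" using eps by (auto simp: power2_eq_square mult_left_le)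
  let ?hc = "corrected_slow \<epsilon> m1 m2"
  \<comment> \<open>The coefficient \<open>c * \<epsilon>\<^sup>2\<close> is the price of a unit of
    phase in \<open>resolves\<close>.\<close>
  define G where "G = (\<lambda>t. norm (?hc (x t) - h (\<epsilon> * t)) + c * \<epsilon>\<^sup>2 * phase_sum (x t))"
  have cph: "\<bar>c * \<epsilon>\<^sup>2 * phase_sum z\<bar> \<le> c * n * \<epsilon>" if "admissible z" for z
  proof -
    have "\<bar>c * \<epsilon>\<^sup>2 * phase_sum z\<bar> \<le> c * \<epsilon> * n"
      unfolding abs_mult using nn e2 phase_sum_bound [OF that] eps by (intro mult_mono) auto
    then show ?thesis by (simp add: mult_ac)
  qed
  have S: "\<tau> / \<epsilon> \<le> S / \<epsilon>" using \<tau> eps by (simp add: divide_right_mono)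
  have "G (\<tau> / \<epsilon>) \<le> ((C1 + c * n) * \<epsilon> + \<epsilon>\<^sup>2 * C2 / (\<epsilon> * L)) * exp (\<epsilon> * L * (\<tau> / \<epsilon>)) - \<epsilon>\<^sup>2 * C2 / (\<epsilon> * L)"
  proof (rule exponential_growth_bound [where S = "\<tau> / \<epsilon>"])
    show "\<epsilon> * L > 0" using eps L by simp
    show "0 \<le> \<tau> / \<epsilon>" using \<tau> eps by simp
    show "0 \<le> (C1 + c * n) * \<epsilon>" "0 \<le> \<epsilon>\<^sup>2 * C2" using nn eps C2 by auto
    have "norm (?hc (x 0) - h 0) \<le> C1 * \<epsilon>"
      unfolding h0 C1_def using adm [of 0] \<tau> eps by (intro corrected_slow_close) auto
    then show "G 0 \<le> (C1 + c * n) * \<epsilon>"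
      using cph [OF adm [of 0]] \<tau> eps by (simp add: G_def algebra_simps)
  next
    fix t assume t: "0 < t" "t \<le> \<tau> / \<epsilon>"
    have x: "(x \<longlongrightarrow> x t) (at_left t)" using traj t S by (auto simp: piston_trajectory_def)
    have \<epsilon>t: "\<epsilon> * t \<in> {0..S}" using t S eps by (auto simp: field_simps)
    have "continuous_on {0..S} h"
      using sol by (auto simp: averaged_solution_def intro!: continuous_on_vector_derivative)
    moreover have "((\<lambda>s. \<epsilon> * s) \<longlongrightarrow> \<epsilon> * t) (at_left t)" by (intro tendsto_intros)
    moreover have "\<forall>\<^sub>F s in at_left t. \<epsilon> * s \<in> {0..S}"
      using eventually_at_left_real [OF t(1)]
    proof eventually_elim
      case (elim s)
      then have "\<epsilon> * s \<le> \<epsilon> * t" using eps by (intro mult_left_mono) auto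
      moreover have "0 \<le> \<epsilon> * s" using elim eps by simp
      ultimately show ?case using \<epsilon>t by simp
    qed
    ultimately have h: "((\<lambda>s. h (\<epsilon> * s)) \<longlongrightarrow> h (\<epsilon> * t)) (at_left t)"
      using \<epsilon>t by (intro continuous_on_tendsto_compose [of "{0..S}" h])
    have "admissible (x t)" using adm t by simp
    from tendsto_corrected [OF this x] h show "(G \<longlongrightarrow> G t) (at_left t)"
      unfolding G_def by (intro tendsto_intros)
  next
    fix t assume t: "0 \<le> t" "t < \<tau> / \<epsilon>"
    have xt: "admissible (x t)" using adm t by simp
    obtain z where z: "post_collision (1 / \<epsilon>\<^sup>2) m1 m2 ord (x t) z"
      and fl: "\<forall>\<^sub>F r in at_right 0. x (t + r) = free_flight r z"
      using traj t S by (force simp: piston_trajectory_def)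
    have res: "resolves (x t) z" using post_collision_resolves [OF xt z] .
    then have az: "admissible z" by (rule resolves_admissible)
    define g where "g = (\<lambda>r. h (\<epsilon> * (t + r)))"
    have g0: "g 0 = h (\<epsilon> * t)" by (simp add: g_def)
    have \<epsilon>t: "0 \<le> \<epsilon> * t" "\<epsilon> * t < \<tau>" using t eps by (auto simp: field_simps)
    have "((h \<circ> (\<lambda>r. \<epsilon> * (t + r))) has_vector_derivative \<epsilon> *\<^sub>R averaged_field m1 m2 (g 0))
        (at 0 within {0..S / \<epsilon> - t})"
    proof (rule vector_diff_chain_within)
      show "((\<lambda>r. \<epsilon> * (t + r)) has_vector_derivative \<epsilon>) (at 0 within {0..S / \<epsilon> - t})"
        unfolding has_real_derivative_iff_has_vector_derivative [symmetric]
        by (auto intro!: derivative_eq_intros)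
      have "(h has_vector_derivative averaged_field m1 m2 (h (\<epsilon> * t))) (at (\<epsilon> * t) within {0..S})"
        using sol \<epsilon>t \<tau> by (auto simp: averaged_solution_def)
      moreover have "(\<lambda>r. \<epsilon> * (t + r)) ` {0..S / \<epsilon> - t} \<subseteq> {0..S}"
        using t eps by (auto simp: field_simps)
      ultimately show "(h has_vector_derivative averaged_field m1 m2 (g 0))
          (at (\<epsilon> * (t + 0)) within (\<lambda>r. \<epsilon> * (t + r)) ` {0..S / \<epsilon> - t})"
        unfolding g0 by (auto intro: has_vector_derivative_within_subset)
    qed
    then have gd: "((\<lambda>r. (g r - g 0) /\<^sub>R r) \<longlongrightarrow> \<epsilon> *\<^sub>R averaged_field m1 m2 (g 0)) (at_right 0)"
      using t S by (intro right_quotient_tendsto [of _ _ "S / \<epsilon> - t"]) (auto simp: g_def o_def)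
    obtain Q' W' s1' s2' where q: "g 0 = (Q', W', s1', s2')" by (cases "g 0")
    have bx: "a \<le> Q' \<and> Q' \<le> 1 - a \<and> \<bar>W'\<bar> \<le> R \<and> (\<forall>j. \<bar>s1' $ j\<bar> \<le> R) \<and> (\<forall>j. \<bar>s2' $ j\<bar> \<le> R)"
      using box [OF \<epsilon>t] q g0 by simp
    define D where "D = norm (?hc z - g 0)"
    \<comment> \<open>The left-hand side is the value of \<open>G\<close> just after the collisions
      at time \<open>t\<close>: their jump is paid for by the drop of the phase sum.\<close>
    have DG: "D + c * \<epsilon>\<^sup>2 * phase_sum z \<le> G t"
    proof -
      have "D \<le> norm (?hc z - ?hc (x t)) + norm (?hc (x t) - g 0)"
        using norm_triangle_ineq [of "?hc z - ?hc (x t)" "?hc (x t) - g 0"] by (simp add: D_def)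
      moreover have "norm (?hc z - ?hc (x t)) \<le> c * \<epsilon>\<^sup>2 * (phase_sum (x t) - phase_sum z)"
        using res by (simp add: resolves_def c_def)
      ultimately show ?thesis by (simp add: G_def g0 right_diff_distrib)
    qed
    \<comment> \<open>The phase sum may be negative, so recovering the distance from
      \<open>G\<close> costs \<open>c * n * \<epsilon>\<close>.\<close>
    have D: "D \<le> G t + c * n * \<epsilon>" using DG cph [OF az] by linarith
    have slope: "\<epsilon> * L * (D + C1 * \<epsilon>) + c * \<epsilon>\<^sup>2 * (n * (2 * R / a)) + \<epsilon>\<^sup>2 \<le> \<epsilon> * L * G t + \<epsilon>\<^sup>2 * C2"
    proof -
      have "\<epsilon> * L * (D + C1 * \<epsilon>) \<le> \<epsilon> * L * (G t + c * n * \<epsilon> + C1 * \<epsilon>)"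
        using D eps L by (intro mult_left_mono) auto
      also have "\<dots> = \<epsilon> * L * G t + \<epsilon>\<^sup>2 * (L * (c * n + C1))"
        by (simp add: algebra_simps power2_eq_square)
      finally show ?thesis by (simp add: C2_def algebra_simps)
    qed
    have "\<forall>\<^sub>F r in at_right 0.
      norm (?hc (free_flight r z) - g r) + (c * \<epsilon>\<^sup>2) * phase_sum (free_flight r z)
      \<le> D + (c * \<epsilon>\<^sup>2) * phase_sum z
      + r * (\<epsilon> * L * (D + C1 * \<epsilon>) + (c * \<epsilon>\<^sup>2) * (n * (2 * R / a)) + \<epsilon>\<^sup>2)"
      unfolding D_def L_def C1_def
      using bx nn e2 by (intro free_flight_growth [OF az gd q]) auto
    then show "\<forall>\<^sub>F r in at_right 0. G (t + r) \<le> G t + r * (\<epsilon> * L * G t + \<epsilon>\<^sup>2 * C2)"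
      using fl eventually_at_right_less [of "0 :: real"]
    proof eventually_elim
      case (elim r)
      have "G (t + r) = norm (?hc (free_flight r z) - g r) + (c * \<epsilon>\<^sup>2) * phase_sum (free_flight r z)"
        using elim(2) by (simp add: G_def g_def)
      moreover have "r * (\<epsilon> * L * (D + C1 * \<epsilon>) + c * \<epsilon>\<^sup>2 * (n * (2 * R / a)) + \<epsilon>\<^sup>2)
        \<le> r * (\<epsilon> * L * G t + \<epsilon>\<^sup>2 * C2)"
        using slope elim(3) by (intro mult_left_mono) auto
      ultimately show ?case using elim(1) DG by linarith
    qed
  qed simp
  also have "\<dots> \<le> ((C1 + c * n) * \<epsilon> + \<epsilon> * (C2 / L)) * exp (L * T)"
  proof -
    have 1: "\<epsilon>\<^sup>2 * C2 / (\<epsilon> * L) = \<epsilon> * (C2 / L)" using eps by (simp add: power2_eq_square)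
    have 2: "\<epsilon> * L * (\<tau> / \<epsilon>) = L * \<tau>" using eps by simp
    have "0 \<le> \<epsilon> * (C2 / L)" using eps C2 L by simp
    moreover have "((C1 + c * n) * \<epsilon> + \<epsilon> * (C2 / L)) * exp (L * \<tau>)
      \<le> ((C1 + c * n) * \<epsilon> + \<epsilon> * (C2 / L)) * exp (L * T)"
      using nn eps C2 L \<tau> by (intro mult_left_mono) auto
    ultimately show ?thesis unfolding 1 2 by linarith
  qed
  finally have GT: "G (\<tau> / \<epsilon>) \<le> (C1 + c * n + C2 / L) * exp (L * T) * \<epsilon>"
    by (simp add: algebra_simps)
  have ax: "admissible (x (\<tau> / \<epsilon>))" using adm \<tau> eps by simp
  have "norm (slow_vars \<epsilon> (x (\<tau> / \<epsilon>)) - h \<tau>)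
    \<le> norm (slow_vars \<epsilon> (x (\<tau> / \<epsilon>)) - ?hc (x (\<tau> / \<epsilon>))) + norm (?hc (x (\<tau> / \<epsilon>)) - h \<tau>)"
    using norm_triangle_ineq [of "slow_vars \<epsilon> (x (\<tau> / \<epsilon>)) - ?hc (x (\<tau> / \<epsilon>))" "?hc (x (\<tau> / \<epsilon>)) - h \<tau>"] by simp
  moreover have "norm (slow_vars \<epsilon> (x (\<tau> / \<epsilon>)) - ?hc (x (\<tau> / \<epsilon>))) \<le> C1 * \<epsilon>"
    using corrected_slow_close [OF ax] by (simp add: norm_minus_commute C1_def)
  moreover have "norm (?hc (x (\<tau> / \<epsilon>)) - h \<tau>) \<le> (C1 + c * n + C2 / L) * exp (L * T) * \<epsilon> + c * n * \<epsilon>"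
    using GT cph [OF ax] eps by (simp add: G_def) 
  ultimately show ?thesis by (simp add: algebra_simps)
qed

end

section \<open>Constants from compactness and the final bound\<close>

lemma compact_open_interval_margin:
  fixes A :: "real set"
  assumes "compact A" "A \<subseteq> {0<..<1}"
  shows "\<exists>a>0. \<forall>x\<in>A. a \<le> x \<and> x \<le> 1 - a"
proof (cases "A = {}")
  case True
  then show ?thesis by (auto intro: exI [of _ 1])
next
  case False
  obtain l where l: "l \<in> A" "\<And>x. x \<in> A \<Longrightarrow> l \<le> x" using compact_attains_inf [OF assms(1) False] by blast
  obtain u where u: "u \<in> A" "\<And>x. x \<in> A \<Longrightarrow> x \<le> u" using compact_attains_sup [OF assms(1) False] by blast
  have "min l (1 - u) > 0" using assms(2) l(1) u(1) by auto
  moreover have "\<forall>x\<in>A. min l (1 - u) \<le> x \<and> x \<le> 1 - min l (1 - u)"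
    using l(2) u(2) by fastforce
  ultimately show ?thesis by blast
qed

lemma compact_positive_lower_bound:
  fixes K :: "real set"
  assumes "compact K" "K \<subseteq> {0<..}"
  shows "\<exists>k>0. \<forall>x\<in>K. k \<le> x"
proof (cases "K = {}")
  case False
  then show ?thesis using compact_attains_inf [OF assms(1) False] assms(2) by blast
qed (auto intro: exI [of _ 1])

theorem theorem3p1p1:
  fixes m1 :: "real ^ 'a::finite" and m2 :: "real ^ 'b::finite"
    and ord :: "('a + 'b) list"
    and \<V> :: "('a, 'b) slow set"
    and A B K :: "real set"
    and T :: real
  assumes "\<forall>j. m1 $ j > 0" and "\<forall>j. m2 $ j > 0"
    and "distinct ord" and "set ord = UNIV"
    and "compact \<V>"
    and "compact A" and "A \<subseteq> {0<..<1}"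
    and "compact B"
    and "compact K" and "K \<subseteq> {0<..}"
    and "\<forall>(Q, W, s1, s2)\<in>\<V>. Q \<in> A \<and> W \<in> B \<and> (\<forall>j. s1 $ j \<in> K) \<and> (\<forall>j. s2 $ j \<in> K)"
    and "T > 0"
  shows "\<exists>C. \<exists>\<epsilon>1>0. \<forall>\<epsilon>. 0 < \<epsilon> \<and> \<epsilon> \<le> \<epsilon>1 \<longrightarrow>
           averaging_error m1 m2 ord \<V> T \<epsilon> \<le> ereal (C * \<epsilon>)"
proof -
  obtain a where a: "a > 0" "\<And>x. x \<in> A \<Longrightarrow> a \<le> x \<and> x \<le> 1 - a"
    using compact_open_interval_margin [OF assms(6,7)] by blast
  obtain k where k: "k > 0" "\<And>x. x \<in> K \<Longrightarrow> k \<le> x"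
    using compact_positive_lower_bound [OF assms(9,10)] by blast
  obtain R0 where R0: "R0 > 0" "\<And>x. x \<in> B \<union> K \<Longrightarrow> \<bar>x\<bar> \<le> R0"
    using compact_imp_bounded [OF compact_Un [OF assms(8,9)]] unfolding bounded_pos real_norm_def by metis
  define \<mu> where "\<mu> = (\<Sum>j\<in>UNIV. m1 $ j) + (\<Sum>j\<in>UNIV. m2 $ j)"
  \<comment> \<open>On the compact set |W| and all speeds are at most \<open>R0\<close>, which
    bounds \<open>energy\<close> by this value.\<close>
  define E where "E = R0\<^sup>2 * (1 + \<mu>)"
  \<comment> \<open>The inserted 1 is the coefficient of the piston term V^2 / \<epsilon>^2, so that
    \<open>mR\<close> also gives E \<le> R^2.\<close>
  define m0 where "m0 = Min (insert 1 (range (($) m1) \<union> range (($) m2)))"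
  have m0: "m0 > 0" "m0 \<le> 1" "\<And>j. m0 \<le> m1 $ j" "\<And>j. m0 \<le> m2 $ j"
    using assms(1,2) unfolding m0_def by (auto intro!: Min_le simp del: Min_insert)
  have s: "0 \<le> (\<Sum>j\<in>UNIV. m1 $ j)" "0 \<le> (\<Sum>j\<in>UNIV. m2 $ j)"
    using assms(1,2) by (auto intro!: sum_nonneg simp: less_imp_le)
  have \<mu>: "m1 $ i \<le> \<mu>" "m2 $ j \<le> \<mu>" for i j
  proof -
    have "m1 $ i \<le> (\<Sum>j\<in>UNIV. m1 $ j)" "m2 $ j \<le> (\<Sum>j\<in>UNIV. m2 $ j)"
      using assms(1,2) by (auto intro!: member_le_sum simp: less_imp_le)
    then show "m1 $ i \<le> \<mu>" "m2 $ j \<le> \<mu>" using s unfolding \<mu>_def by linarith+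
  qed
  have \<mu>0: "\<mu> \<ge> 0" using s by (simp add: \<mu>_def)
  have E0: "E \<ge> 0" using \<mu>0 by (simp add: E_def)
  \<comment> \<open>R \<ge> 1 and R \<ge> E / m0 imply m0 R^2 \<ge> E without a square root.\<close>
  define R where "R = 1 + R0 + E / m0"
  have R: "1 \<le> R" "R0 \<le> R" "E / m0 \<le> R" using R0(1) E0 m0 by (auto simp: R_def)
  have mR: "E \<le> m * R\<^sup>2" if "m0 \<le> m" for m
  proof -
    have "E = m0 * (E / m0)" using m0 by simp
    also have "\<dots> \<le> m * (R * R)"
      using that m0 R E0 mult_mono [of 1 R "E / m0" R] by (intro mult_mono) auto
    finally show ?thesis by (simp add: power2_eq_square)
  qed
  define n where "n = real CARD('a) + real CARD('b)"
  define L where "L = field_lipschitz m1 m2 a (2 * R)"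
  define C1 where "C1 = n * (\<mu> + 1) * R"
  define c where "c = 2 * n * \<mu> * R"
  define C2 where "C2 = L * (c * n + C1) + c * n * (2 * R / a) + 1"
  define C where "C = C1 + c * n + (C1 + c * n + C2 / L) * exp (L * T)"
  define \<epsilon>1 where "\<epsilon>1 = min 1 (min (k / (16 * R)) (1 / (4 * (\<mu> + 1))))"
  have "\<epsilon>1 > 0" using k R \<mu>0 by (simp add: \<epsilon>1_def)
  moreover have "averaging_error m1 m2 ord \<V> T \<epsilon> \<le> ereal (C * \<epsilon>)" if \<epsilon>: "0 < \<epsilon>" "\<epsilon> \<le> \<epsilon>1" for \<epsilon>
  proof -
    have e: "\<epsilon> \<le> 1" "\<epsilon> \<le> k / (16 * R)" "\<epsilon> \<le> 1 / (4 * (\<mu> + 1))" using \<epsilon> by (auto simp: \<epsilon>1_def)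
    interpret slow_piston m1 m2 \<epsilon> a k E R \<mu> n
    proof
      show "\<epsilon> * R \<le> k / 16" using e(2) R by (simp add: field_simps)
      have "\<mu> * \<epsilon>\<^sup>2 \<le> (\<mu> + 1) * \<epsilon>"
        using \<mu>0 \<epsilon> e(1) by (intro mult_mono) (auto simp: power2_eq_square mult_left_le)
      also have "\<dots> \<le> 1 / 4" using e(3) \<mu>0 by (simp add: field_simps)
      finally show "\<mu> * \<epsilon>\<^sup>2 \<le> 1 / 4" .
      show "E \<le> R\<^sup>2" using mR [of 1] m0 by simp
    qed (use \<epsilon> e a k R \<mu> m0 mR assms(1,2) in \<open>auto simp: n_def\<close>)
    have V: "a \<le> Q \<and> Q \<le> 1 - a \<and> \<bar>W\<bar> \<le> R0 \<and> (\<forall>j. k \<le> s1 $ j \<and> \<bar>s1 $ j\<bar> \<le> R0) \<and>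
        (\<forall>j. k \<le> s2 $ j \<and> \<bar>s2 $ j\<bar> \<le> R0)" if "(Q, W, s1, s2) \<in> \<V>" for Q W s1 s2
      using assms(11) that a k R0 by fastforce
    have adm: "admissible z" if ps: "z \<in> phase_space" and zV: "slow_vars \<epsilon> z \<in> \<V>" for z
    proof -
      obtain Q V q1 v1 q2 v2 where f: "z = (Q, V, q1, v1, q2, v2)" by (cases z)
      note v = V [OF zV [unfolded f slow_vars.simps]]
      have sq: "x\<^sup>2 \<le> R0\<^sup>2" if "\<bar>x\<bar> \<le> R0" for x
        using that power_mono [of "\<bar>x\<bar>" R0 2] by simp
      have "V\<^sup>2 / \<epsilon>\<^sup>2 \<le> R0\<^sup>2" using sq [of "V / \<epsilon>"] v by (simp add: power_divide)
      moreover have "(\<Sum>j\<in>UNIV. m1 $ j * (v1 $ j)\<^sup>2) \<le> (\<Sum>j\<in>UNIV. m1 $ j * R0\<^sup>2)"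
        using v assms(1) by (intro sum_mono mult_left_mono sq) (auto simp: less_imp_le)
      moreover have "(\<Sum>j\<in>UNIV. m2 $ j * (v2 $ j)\<^sup>2) \<le> (\<Sum>j\<in>UNIV. m2 $ j * R0\<^sup>2)"
        using v assms(2) by (intro sum_mono mult_left_mono sq) (auto simp: less_imp_le)
      ultimately have "energy \<epsilon> m1 m2 (Q, V, q1, v1, q2, v2) \<le> E"
        by (simp add: E_def \<mu>_def sum_distrib_right [symmetric] algebra_simps)
      then show ?thesis using v ps unfolding f admissible.simps by (auto simp: phase_space_def)
    qed
    show ?thesis
      unfolding averaging_error_def
    proof (rule Sup_least, clarify)
      fix x :: "real \<Rightarrow> ('a, 'b) state" and h S \<tau>
      assume traj: "piston_trajectory (1 / \<epsilon>\<^sup>2) m1 m2 ord (S / \<epsilon>) x" and x0: "slow_vars \<epsilon> (x 0) \<in> \<V>"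
        and sol: "averaged_solution m1 m2 S h" and h0: "h 0 = slow_vars \<epsilon> (x 0)"
        and \<tau>: "0 \<le> \<tau>" "\<tau> \<le> S" and exit: "ereal \<tau> \<le> min (ereal T) (exit_time \<V> \<epsilon> x h)"
      \<comment> \<open>Strictly before \<tau> only, because an infimum does not tell whether the
        set is already left at the exit time itself.\<close>
      have inside: "h s \<in> \<V> \<and> slow_vars \<epsilon> (x (s / \<epsilon>)) \<in> \<V>" if "0 \<le> s" "s < \<tau>" for s
      proof (rule ccontr)
        assume "\<not> ?thesis"
        then have "exit_time \<V> \<epsilon> x h \<le> ereal s"
          unfolding exit_time_def using that by (intro Inf_lower) blast
        then have "ereal \<tau> \<le> ereal s" using exit by (meson min.boundedE order_trans)
        then show False using that by simp
      qed
      have "slow_vars \<epsilon> (x t) \<in> \<V>" if t: "0 \<le> t" "t \<le> \<tau> / \<epsilon>" for t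
      proof -
        consider "t < \<tau> / \<epsilon>" | "t = 0" | "t = \<tau> / \<epsilon>" "0 < t" using t by linarith
        then show ?thesis
        proof cases
          case 1
          then show ?thesis using inside [of "\<epsilon> * t"] t \<epsilon> by (simp add: field_simps)
        next
          \<comment> \<open>Covers \<tau> = 0, where no earlier time exists.\<close>
          case 2
          then show ?thesis using x0 by simp
        next
          \<comment> \<open>Left continuity and closedness of the compact set carry membership to
            the end point, which \<open>inside\<close> omits.\<close>
          case 3
          have "t \<le> S / \<epsilon>" using 3 \<tau> \<epsilon> by (simp add: divide_right_mono)
          then have "(x \<longlongrightarrow> x t) (at_left t)" using traj 3 by (auto simp: piston_trajectory_def)
          then have "((\<lambda>t. slow_vars \<epsilon> (x t)) \<longlongrightarrow> slow_vars \<epsilon> (x t)) (at_left t)"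
            using \<epsilon> by (intro tendsto_slow_vars) auto
          moreover have "\<forall>\<^sub>F r in at_left t. slow_vars \<epsilon> (x r) \<in> \<V>"
            using eventually_at_left_real [OF 3(2)]
          proof eventually_elim
            case (elim r)
            then have "\<epsilon> * r < \<tau>" using 3 \<epsilon> by (simp add: field_simps)
            then show ?case using inside [of "\<epsilon> * r"] elim \<epsilon> by simp
          qed
          ultimately show ?thesis
            using compact_imp_closed [OF assms(5)] by (intro Lim_in_closed_set) auto
        qed
      qed
      moreover have "x t \<in> phase_space" if "0 \<le> t" "t \<le> \<tau> / \<epsilon>" for t
      proof -
        have "\<tau> / \<epsilon> \<le> S / \<epsilon>" using \<tau> \<epsilon> by (simp add: divide_right_mono)
        then show ?thesis using traj that by (auto simp: piston_trajectory_def)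
      qed
      ultimately have ax: "admissible (x t)" if "0 \<le> t" "t \<le> \<tau> / \<epsilon>" for t using adm that by blast
      have "norm (slow_vars \<epsilon> (x (\<tau> / \<epsilon>)) - h \<tau>) \<le> C * \<epsilon>"
        unfolding C_def C2_def C1_def c_def L_def
      proof (rule averaging_estimate [OF traj sol h0 \<tau> _ ax])
        show "\<tau> \<le> T" using exit by simp
        fix t Q W s1 s2 assume "0 \<le> t" "t < \<tau>" "h t = (Q, W, s1, s2)"
        then have "(Q, W, s1, s2) \<in> \<V>" using inside by metis
        from V [OF this]
        show "a \<le> Q \<and> Q \<le> 1 - a \<and> \<bar>W\<bar> \<le> R \<and> (\<forall>j. \<bar>s1 $ j\<bar> \<le> R) \<and> (\<forall>j. \<bar>s2 $ j\<bar> \<le> R)"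
          using R(2) order_trans by blast
      qed
      then show "ereal (norm (slow_vars \<epsilon> (x (\<tau> / \<epsilon>)) - h \<tau>)) \<le> ereal (C * \<epsilon>)" by simp
    qed
  qed
  ultimately show ?thesis by blast
qed

end
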